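(* Let $p<n$ be positive integers and $t>0$. Equip $\mathrm{SO}(n)$ with the left-invariant metric given by the inner product $\langle\,,\rangle_{\mathrm P}$, $\mathrm P=\mathrm P_t$, on $\mathfrak{o}(n)$ described in the context, and equip $\mathrm{St}_{p,n}=\{Y\in\mathbb{R}^{n\times p}:Y^{\mathsf T}Y=I_p\}$, identified with $\mathrm{SO}(n)/\mathrm{SO}(n-p)$ through the submersion $U=(Y|Y_\perp)\mapsto Y$, with the quotient metric. (1) The horizontal lift of a tangent vector $\eta\in\mathbb{R}^{n\times p}$ to $\mathrm{St}_{p,n}$ at $Y$ to a tangent vector at $U=(Y|Y_\perp)\in\mathrm{SO}(n)$ is $\bar\eta=(\eta\,|-Y\eta^{\mathsf T}Y_\perp)$, and the induced metric on $\mathrm{St}_{p,n}$ is $$\langle\eta,\eta\rangle_t=\operatorname{Tr}\Big(\eta\eta^{\mathsf T}+\big(\tfrac t2-1\big)YY^{\mathsf T}\eta\eta^{\mathsf T}\Big).$$ (2) The Levi-Civita connection of this metric for two vector fields $V,Z$ on $\mathrm{St}_{p,n}$ is $$\nabla_VZ=\mathrm D_VZ+\tfrac12Y(V^{\mathsf T}Z+Z^{\mathsf T}V)+\tfrac{2-t}{2}(I_n-YY^{\mathsf T})(VZ^{\mathsf T}+ZV^{\mathsf T})Y.$$ (3) Let $\xi=YA_1+Y_\perp B_1$, $\eta=YA_2+Y_\perp B_2$, $\phi=YA_3+Y_\perp B_3$ be tangent vectors at $Y$ with $A_i\in\mathfrak{o}(p)$, $B_i\in\mathbb{R}^{(n-p)\times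 p}$, and let $\omega_i=[\![A_i,B_i,0]\!]$. The curvature $R_{\xi,\eta}\phi$ at $Y$ of this metric, whose horizontal lift at $U=(Y|Y_\perp)$ is $U\hat R$ with $$\begin{aligned}\hat R=\Big(&\tfrac12[[\omega_1,\omega_2],\omega_3]_{\mathrm P}-\tfrac14[\omega_1,[\omega_2,\omega_3]_{\mathrm P}]_{\mathrm P}+\tfrac14[\omega_2,[\omega_1,\omega_3]_{\mathrm P}]_{\mathrm P}\\&+\tfrac12\operatorname{ad}^\dagger_{\omega_3}[\omega_1,\omega_2]_{\mathfrak k}-\tfrac14\operatorname{ad}^\dagger_{\omega_1}[\omega_2,\omega_3]_{\mathfrak k}+\tfrac14\operatorname{ad}^\dagger_{\omega_2}[\omega_1,\omega_3]_{\mathfrak k}\Big)_{\mathfrak m},\end{aligned}$$ equals $YA_R+Y_\perp B_R$ (equivalently, $\hat R=[\![A_R,B_R,0]\!]$), where, with $\alpha=t/2$, $$\begin{aligned}A_R={}&\tfrac{1-2\alpha}{4}\big(A_1B_3^{\mathsf T}B_2-A_2B_3^{\mathsf T}B_1-B_1^{\mathsf T}B_3A_2+B_2^{\mathsf T}B_3A_1\big)\\&+\tfrac{1-\alpha}{2}\big(A_3B_1^{\mathsf T}B_2-A_3B_2^{\mathsf T}B_1-B_1^{\mathsf T}B_2A_3+B_2^{\mathsf T}B_1A_3\big)\\&+\tfrac14\big([[A_1,A_2],A_3]-A_1B_2^{\mathsf T}B_3+A_2B_1^{\mathsf T}B_3+B_3^{\mathsf T}B_1A_2-B_3^{\mathsf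 T}B_2A_1\big),\end{aligned}$$ $$\begin{aligned}B_R={}&\tfrac{2\alpha^2-\alpha}{2}(B_1A_3A_2-B_2A_3A_1)+(\alpha^2-\alpha)(B_3A_1A_2-B_3A_2A_1)\\&+(1-\alpha)(B_3B_1^{\mathsf T}B_2-B_3B_2^{\mathsf T}B_1)+\tfrac{\alpha-2}{2}(B_1B_2^{\mathsf T}B_3-B_2B_1^{\mathsf T}B_3)\\&+\tfrac{\alpha}{2}(B_1A_2A_3-B_1B_3^{\mathsf T}B_2-B_2A_1A_3+B_2B_3^{\mathsf T}B_1).\end{aligned}$$
   Context: $\mathfrak{o}(n)$ is the Lie algebra of antisymmetric $n\times n$ matrices with bracket $[X,Y]=XY-YX$ and bi-invariant inner product $\langle\omega_1,\omega_2\rangle=\frac12\operatorname{Tr}(\omega_1^{\mathsf T}\omega_2)$. For $A\in\mathfrak{o}(p)$, $B\in\mathbb{R}^{(n-p)\times p}$, $H\in\mathfrak{o}(n-p)$, $[\![A,B,H]\!]$ denotes $\begin{bmatrix}A & -B^{\mathsf T} \\ B & H\end{bmatrix}\in\mathfrak{o}(n)$. Let $\mathfrak a=\{[\![A,0,0]\!]\}\cong\mathfrak{o}(p)$, $\mathfrak b=\{[\![0,B,0]\!]\}$, $\mathfrak k=\mathfrak h=\{[\![0,0,H]\!]\}\cong\mathfrak{o}(n-p)$, $\mathfrak n=\mathfrak b\oplus\mathfrak h$, $\mathfrak m=\mathfrak a\oplus\mathfrak b$. For a subspace $\mathfrak v$, $\omega_{\mathfrak v}$ is the orthogonal projection of $\omega$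 to $\mathfrak v$. Define $\mathrm P_t\omega=t\,\omega_{\mathfrak a}+\omega_{\mathfrak n}$ and $\langle\omega_1,\omega_2\rangle_{\mathrm P}=\langle\omega_1,\mathrm P_t\omega_2\rangle$. Let $\operatorname{ad}_A X=[A,X]$, let $\operatorname{ad}^\dagger_A$ be the adjoint of $\operatorname{ad}_A$ under $\langle\,,\rangle_{\mathrm P}$, and $[A,B]_{\mathrm P}=[A,B]-\operatorname{ad}^\dagger_AB-\operatorname{ad}^\dagger_BA$. $(Y|Y_\perp)$ denotes the division of an $n\times n$ matrix into its first $p$ and last $n-p$ columns; for $U=(Y|Y_\perp)\in\mathrm{SO}(n)$ the group $\mathrm{SO}(n-p)$ acts by $(Y|Y_\perp)\mapsto(Y|Y_\perp Q)$. The vertical space at $U$ is $\{U[\![0,0,H]\!]\}$, the horizontal space is $\{U[\![A,B,0]\!]\}$, and the submersion sends a tangent vector $(\eta|\eta_\perp)$ to $\eta$. A tangent vector $\eta$ to $\mathrm{St}_{p,n}$ at $Y$ is a matrix $\eta\in\mathbb{R}^{n\times p}$ with $Y^{\mathsf T}\eta\in\mathfrak{o}(p)$. Vector fields on $\mathrm{St}_{p,n}$ are regarded as $\mathbb{R}^{n\times p}$-valued functions, and $\mathrm D_VZ$ is the directional derivative of $Z$ in direction $V$. Curvature sign convention: $R_{XY}Z=\nabla_{[X,Y]}Z-\nabla_X\nabla_YZ+\nabla_Y\nabla_XZ$. *)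

theory Defs
  imports "HOL-Analysis.Analysis"
begin

text \<open>
  An n by p matrix with 0 < p < n is an element of \<open>real^'p^('p + 'q)\<close>, where \<open>CARD('p) = p\<close> and
  \<open>CARD('q) = n - p\<close>. The first p rows or columns of a matrix carry the indices \<open>Inl i\<close>, the
  last n - p the indices \<open>Inr j\<close>.
\<close>

section \<open>Smooth functions, vector fields and connections on a subset of a Euclidean space\<close>

primrec Ck_on :: "nat \<Rightarrow> ('a::euclidean_space \<Rightarrow> 'b::euclidean_space) \<Rightarrow> 'a set \<Rightarrow> bool" where
  "Ck_on 0 f W = continuous_on W f"
| "Ck_on (Suc k) f W =
     ((\<forall>x\<in>W. f differentiable (at x)) \<and> (\<forall>v. Ck_on k (\<lambda>x. frechet_derivative f (at x) v) W))"

definition smooth_on :: "'a::euclidean_space set \<Rightarrow> ('a \<Rightarrow> 'b::euclidean_space) \<Rightarrow> bool" where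
  "smooth_on S f \<longleftrightarrow>
     (\<forall>x\<in>S. \<exists>W F. open W \<and> x \<in> W \<and> (\<forall>k. Ck_on k F W) \<and> (\<forall>y\<in>S \<inter> W. F y = f y))"

text \<open>
  The derivative of a function on a submanifold \<open>S\<close> in the tangent direction \<open>v\<close> at \<open>x\<close> is taken
  along curves in \<open>S\<close>, so that it depends only on the values of \<open>f\<close> on \<open>S\<close>. It is unspecified
  if \<open>v\<close> is not the velocity of such a curve.
\<close>

definition dir_deriv ::
  "'a::euclidean_space set \<Rightarrow> ('a \<Rightarrow> 'b::euclidean_space) \<Rightarrow> 'a \<Rightarrow> 'a \<Rightarrow> 'b" where
  "dir_deriv S f x v =
     (THE d. \<forall>\<gamma> :: real \<Rightarrow> 'a. (\<forall>s. \<gamma> s \<in> S) \<and> \<gamma> 0 = x \<and> (\<gamma> has_vector_derivative v) (at 0) \<longrightarrow>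
        ((\<lambda>s. f (\<gamma> s)) has_vector_derivative d) (at 0))"

text \<open>
  In the following, \<open>S\<close> is a submanifold and \<open>Tan x\<close> its tangent space at \<open>x\<close>. Vector fields are
  functions with values in the ambient space; their values outside \<open>S\<close> are irrelevant.
\<close>

definition vector_field ::
  "'a::euclidean_space set \<Rightarrow> ('a \<Rightarrow> 'a set) \<Rightarrow> ('a \<Rightarrow> 'a) \<Rightarrow> bool" where
  "vector_field S Tan V \<longleftrightarrow> smooth_on S V \<and> (\<forall>x\<in>S. V x \<in> Tan x)"

definition lie_bracket ::
  "'a::euclidean_space set \<Rightarrow> ('a \<Rightarrow> 'a) \<Rightarrow> ('a \<Rightarrow> 'a) \<Rightarrow> 'a \<Rightarrow> 'a" where
  "lie_bracket S V Z x = dir_deriv S Z x (V x) - dir_deriv S V x (Z x)"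

definition affine_connection ::
  "'a::euclidean_space set \<Rightarrow> ('a \<Rightarrow> 'a set) \<Rightarrow> (('a \<Rightarrow> 'a) \<Rightarrow> ('a \<Rightarrow> 'a) \<Rightarrow> 'a \<Rightarrow> 'a) \<Rightarrow> bool" where
  "affine_connection S Tan nab \<longleftrightarrow>
     (\<forall>V Z. vector_field S Tan V \<and> vector_field S Tan Z \<longrightarrow> vector_field S Tan (nab V Z)) \<and>
     (\<forall>V W Z. vector_field S Tan V \<and> vector_field S Tan W \<and> vector_field S Tan Z \<longrightarrow>
        (\<forall>x\<in>S. nab (\<lambda>y. V y + W y) Z x = nab V Z x + nab W Z x)) \<and>
     (\<forall>f :: 'a \<Rightarrow> real. \<forall>V Z. smooth_on S f \<and> vector_field S Tan V \<and> vector_field S Tan Z \<longrightarrow>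
        (\<forall>x\<in>S. nab (\<lambda>y. f y *\<^sub>R V y) Z x = f x *\<^sub>R nab V Z x)) \<and>
     (\<forall>V W Z. vector_field S Tan V \<and> vector_field S Tan W \<and> vector_field S Tan Z \<longrightarrow>
        (\<forall>x\<in>S. nab V (\<lambda>y. W y + Z y) x = nab V W x + nab V Z x)) \<and>
     (\<forall>f :: 'a \<Rightarrow> real. \<forall>V Z. smooth_on S f \<and> vector_field S Tan V \<and> vector_field S Tan Z \<longrightarrow>
        (\<forall>x\<in>S. nab V (\<lambda>y. f y *\<^sub>R Z y) x =
           dir_deriv S f x (V x) *\<^sub>R Z x + f x *\<^sub>R nab V Z x))"

definition levi_civita ::
  "'a::euclidean_space set \<Rightarrow> ('a \<Rightarrow> 'a set) \<Rightarrow> ('a \<Rightarrow> 'a \<Rightarrow> 'a \<Rightarrow> real) \<Rightarrow>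
     (('a \<Rightarrow> 'a) \<Rightarrow> ('a \<Rightarrow> 'a) \<Rightarrow> 'a \<Rightarrow> 'a) \<Rightarrow> bool" where
  "levi_civita S Tan g nab \<longleftrightarrow>
     affine_connection S Tan nab \<and>
     (\<forall>V Z. vector_field S Tan V \<and> vector_field S Tan Z \<longrightarrow>
        (\<forall>x\<in>S. nab V Z x - nab Z V x = lie_bracket S V Z x)) \<and>
     (\<forall>V W Z. vector_field S Tan V \<and> vector_field S Tan W \<and> vector_field S Tan Z \<longrightarrow>
        (\<forall>x\<in>S. dir_deriv S (\<lambda>y. g y (W y) (Z y)) x (V x) =
           g x (nab V W x) (Z x) + g x (W x) (nab V Z x)))"

text \<open>The sign convention is \<open>R\<^sub>X\<^sub>Y Z = \<nabla>\<^bsub>[X,Y]\<^esub> Z - \<nabla>\<^sub>X \<nabla>\<^sub>Y Z + \<nabla>\<^sub>Y \<nabla>\<^sub>X Z\<close>.\<close>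

definition curvature_field ::
  "'a::euclidean_space set \<Rightarrow> (('a \<Rightarrow> 'a) \<Rightarrow> ('a \<Rightarrow> 'a) \<Rightarrow> 'a \<Rightarrow> 'a) \<Rightarrow>
     ('a \<Rightarrow> 'a) \<Rightarrow> ('a \<Rightarrow> 'a) \<Rightarrow> ('a \<Rightarrow> 'a) \<Rightarrow> 'a \<Rightarrow> 'a" where
  "curvature_field S nab X Y Z x =
     nab (lie_bracket S X Y) Z x - nab X (nab Y Z) x + nab Y (nab X Z) x"

text \<open>
  The curvature tensor at \<open>x\<close> maps the tangent vectors \<open>u, v, w\<close> to \<open>r\<close>: every choice of vector
  fields extending them gives the value \<open>r\<close>, and such vector fields exist.
\<close>

definition has_curvature_at ::
  "'a::euclidean_space set \<Rightarrow> ('a \<Rightarrow> 'a set) \<Rightarrow> (('a \<Rightarrow> 'a) \<Rightarrow> ('a \<Rightarrow> 'a) \<Rightarrow> 'a \<Rightarrow> 'a) \<Rightarrow>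
     'a \<Rightarrow> 'a \<Rightarrow> 'a \<Rightarrow> 'a \<Rightarrow> 'a \<Rightarrow> bool" where
  "has_curvature_at S Tan nab x u v w r \<longleftrightarrow>
     (\<exists>X Y Z. vector_field S Tan X \<and> vector_field S Tan Y \<and> vector_field S Tan Z \<and>
        X x = u \<and> Y x = v \<and> Z x = w) \<and>
     (\<forall>X Y Z. vector_field S Tan X \<and> vector_field S Tan Y \<and> vector_field S Tan Z \<and>
        X x = u \<and> Y x = v \<and> Z x = w \<longrightarrow> curvature_field S nab X Y Z x = r)"

section \<open>The Lie algebra of antisymmetric matrices\<close>

definition antisym_mats :: "(real^'n^'n) set" where
  "antisym_mats = {X. transpose X = - X}"

definition comm_bracket :: "real^'n^'n \<Rightarrow> real^'n^'n \<Rightarrow> real^'n^'n" where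
  "comm_bracket X Y = X ** Y - Y ** X"

definition ip :: "real^'n^'n \<Rightarrow> real^'n^'n \<Rightarrow> real" where
  "ip X Y = trace (transpose X ** Y) / 2"

definition oproj :: "(real^'n^'n) set \<Rightarrow> real^'n^'n \<Rightarrow> real^'n^'n" where
  "oproj V X = (THE Z. Z \<in> V \<and> (\<forall>W\<in>V. ip (X - Z) W = 0))"

definition blk :: "real^('p::finite)^'p \<Rightarrow> real^'p^('q::finite) \<Rightarrow> real^'q^'q \<Rightarrow> real^('p + 'q)^('p + 'q)" where
  "blk A B H = (\<chi> i j. case i of
      Inl k \<Rightarrow> (case j of Inl l \<Rightarrow> A $ k $ l | Inr l \<Rightarrow> - (B $ l $ k))
    | Inr k \<Rightarrow> (case j of Inl l \<Rightarrow> B $ k $ l | Inr l \<Rightarrow> H $ k $ l))"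

definition a_sub :: "(real^('p::finite + 'q::finite)^('p + 'q)) set" where
  "a_sub = {blk A 0 0 | A. A \<in> antisym_mats}"

definition b_sub :: "(real^('p::finite + 'q::finite)^('p + 'q)) set" where
  "b_sub = {blk 0 B 0 | B. True}"

definition k_sub :: "(real^('p::finite + 'q::finite)^('p + 'q)) set" where
  "k_sub = {blk 0 0 H | H. H \<in> antisym_mats}"

definition n_sub :: "(real^('p::finite + 'q::finite)^('p + 'q)) set" where
  "n_sub = {X + Z | X Z. X \<in> b_sub \<and> Z \<in> k_sub}"

definition m_sub :: "(real^('p::finite + 'q::finite)^('p + 'q)) set" where
  "m_sub = {X + Z | X Z. X \<in> a_sub \<and> Z \<in> b_sub}"

definition P_op :: "real \<Rightarrow> real^('p::finite + 'q::finite)^('p + 'q) \<Rightarrow> real^('p + 'q)^('p + 'q)" where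
  "P_op t X = t *\<^sub>R oproj a_sub X + oproj n_sub X"

definition ip_P :: "real \<Rightarrow> real^('p::finite + 'q::finite)^('p + 'q) \<Rightarrow> real^('p + 'q)^('p + 'q) \<Rightarrow> real" where
  "ip_P t X Y = ip X (P_op t Y)"

definition ad_dagger ::
  "real \<Rightarrow> real^('p::finite + 'q::finite)^('p + 'q) \<Rightarrow> real^('p + 'q)^('p + 'q) \<Rightarrow> real^('p + 'q)^('p + 'q)" where
  "ad_dagger t A X = (THE Z. Z \<in> antisym_mats \<and>
     (\<forall>W\<in>antisym_mats. ip_P t (comm_bracket A W) X = ip_P t W Z))"

definition bracket_P ::
  "real \<Rightarrow> real^('p::finite + 'q::finite)^('p + 'q) \<Rightarrow> real^('p + 'q)^('p + 'q) \<Rightarrow> real^('p + 'q)^('p + 'q)" where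
  "bracket_P t A B = comm_bracket A B - ad_dagger t A B - ad_dagger t B A"

section \<open>The submersion from the special orthogonal group to the Stiefel manifold\<close>

definition SO_group :: "(real^'n^'n) set" where
  "SO_group = {U. rotation_matrix U}"

definition left_cols :: "real^('p::finite + 'q::finite)^'n \<Rightarrow> real^'p^'n" where
  "left_cols U = (\<chi> i k. U $ i $ Inl k)"

definition right_cols :: "real^('p::finite + 'q::finite)^'n \<Rightarrow> real^'q^'n" where
  "right_cols U = (\<chi> i k. U $ i $ Inr k)"

definition join_cols :: "real^('p::finite)^'n \<Rightarrow> real^('q::finite)^'n \<Rightarrow> real^('p + 'q)^'n" where
  "join_cols Y Z = (\<chi> i j. case j of Inl k \<Rightarrow> Y $ i $ k | Inr k \<Rightarrow> Z $ i $ k)"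

text \<open>The left-invariant metric on the special orthogonal group, for tangent vectors at \<open>U\<close>:\<close>

definition SO_metric ::
  "real \<Rightarrow> real^('p::finite + 'q::finite)^('p + 'q) \<Rightarrow> real^('p + 'q)^('p + 'q) \<Rightarrow> real^('p + 'q)^('p + 'q) \<Rightarrow> real" where
  "SO_metric t U v w = ip_P t (matrix_inv U ** v) (matrix_inv U ** w)"

text \<open>
  The vertical space at \<open>U\<close>, the tangent space of the fibre of \<open>left_cols\<close>, consists of the
  matrices \<open>U ** blk 0 0 H\<close> with \<open>H\<close> antisymmetric; the horizontal space is its orthogonal
  complement for \<open>SO_metric t U\<close> in the tangent space of all \<open>U ** blk A B H\<close> with \<open>A\<close> and \<open>H\<close>
  antisymmetric.
\<close>

definition horizontal_space :: "real^('p::finite + 'q::finite)^('p + 'q) \<Rightarrow> (real^('p + 'q)^('p + 'q)) set" where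
  "horizontal_space U = {U ** blk A B 0 | A B. A \<in> antisym_mats}"

text \<open>
  The submersion is the restriction of the linear map \<open>left_cols\<close>, so its differential is
  \<open>left_cols\<close> as well.
\<close>

definition is_horizontal_lift ::
  "real^('p::finite + 'q::finite)^('p + 'q) \<Rightarrow> real^'p^('p + 'q) \<Rightarrow> real^('p + 'q)^('p + 'q) \<Rightarrow> bool" where
  "is_horizontal_lift U \<eta> v \<longleftrightarrow> v \<in> horizontal_space U \<and> left_cols v = \<eta>"

definition Stiefel :: "(real^'p^('p::finite + 'q::finite)) set" where
  "Stiefel = {Y. transpose Y ** Y = mat 1}"

definition Stiefel_tangent :: "real^'p^('p::finite + 'q::finite) \<Rightarrow> (real^'p^('p + 'q)) set" where
  "Stiefel_tangent Y = {\<eta>. transpose Y ** \<eta> \<in> antisym_mats}"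

text \<open>
  The quotient metric at \<open>Y\<close>: the common value of the metric on horizontal lifts at all points
  \<open>U\<close> of the fibre over \<open>Y\<close>.
\<close>

definition quotient_metric ::
  "real \<Rightarrow> real^'p^('p::finite + 'q::finite) \<Rightarrow> real^'p^('p + 'q) \<Rightarrow> real^'p^('p + 'q) \<Rightarrow> real" where
  "quotient_metric t Y \<eta> \<zeta> = (THE r. \<forall>U v w. U \<in> SO_group \<and> left_cols U = Y \<and>
     is_horizontal_lift U \<eta> v \<and> is_horizontal_lift U \<zeta> w \<longrightarrow> r = SO_metric t U v w)"

end

theory Submission
  imports Defs
begin

text \<open>
  The manifold is handled through functions on the ambient space \<open>\<real>\<^bsup>n\<times>p\<^esup>\<close>. A connection
  of the form \<open>D\<^sub>V Z + \<Gamma>(V, Z)\<close> with \<open>\<Gamma>\<close> bilinear and symmetric is torsion free, and its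
  curvature \<open>R\<^sub>X\<^sub>Y Z\<close> is \<open>(D\<^sub>Y \<Gamma>)(X, Z) - (D\<^sub>X \<Gamma>)(Y, Z) + \<Gamma>(Y, \<Gamma>(X, Z)) - \<Gamma>(X, \<Gamma>(Y, Z))\<close>:
  all second derivatives cancel because \<open>D\<^sub>X D\<^sub>Y - D\<^sub>Y D\<^sub>X = D\<^bsub>[X,Y]\<^esub>\<close>. For the given \<open>\<Gamma>\<close>, tangency
  follows by differentiating \<open>Y\<^sup>T Z + Z\<^sup>T Y = 0\<close> along the manifold, and compatibility with the
  metric is an identity in the coordinates \<open>Y A + Y\<^sub>\<bottom> B\<close>. In the same coordinates the curvature
  becomes a noncommutative polynomial in the \<open>A\<^sub>i, B\<^sub>i\<close>. The lifted formula is evaluated in block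
  form, where \<open>ad\<^sup>\<dagger>\<^sub>A X = P\<^sup>-\<^sup>1 [P X, A]\<close>, and the two polynomials agree.
\<close>

section \<open>Higher derivatives\<close>

lemma Ck_on_cong:
  assumes "open W" and "\<And>x. x \<in> W \<Longrightarrow> f x = g x"
  shows "Ck_on k f W \<longleftrightarrow> Ck_on k g W"
  using assms(2)
proof (induction k arbitrary: f g)
  case 0
  then show ?case by (auto cong: continuous_on_cong)
next
  case (Suc k)
  have d: "(f has_derivative D) (at x) \<longleftrightarrow> (g has_derivative D) (at x)" if "x \<in> W" for x D
    using has_derivative_transform_within_open[OF _ assms(1) that, of f D UNIV g]
      has_derivative_transform_within_open[OF _ assms(1) that, of g D UNIV f] Suc.prems by auto
  have 1: "f differentiable (at x) \<longleftrightarrow> g differentiable (at x)" if "x \<in> W" for x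
    using d[OF that] by (simp add: differentiable_def)
  have 2: "frechet_derivative f (at x) v = frechet_derivative g (at x) v" if "x \<in> W" for x v
    using d[OF that] by (simp add: frechet_derivative_def)
  have "Ck_on k (\<lambda>x. frechet_derivative f (at x) v) W \<longleftrightarrow>
        Ck_on k (\<lambda>x. frechet_derivative g (at x) v) W" for v
    by (rule Suc.IH) (rule 2)
  with 1 show ?case by simp
qed

lemma Ck_on_subset: "Ck_on k f W \<Longrightarrow> V \<subseteq> W \<Longrightarrow> Ck_on k f V"
proof (induction k arbitrary: f)
  case 0
  then show ?case using continuous_on_subset by auto
next
  case (Suc k)
  then show ?case by auto
qed

lemma Ck_on_Suc_imp: "Ck_on (Suc k) f W \<Longrightarrow> Ck_on k f W"
proof (induction k arbitrary: f)
  case 0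
  then show ?case
    by (auto intro!: continuous_at_imp_continuous_on differentiable_imp_continuous_within)
next
  case (Suc k)
  show ?case
    unfolding Ck_on.simps(2)[of k]
  proof (intro conjI allI)
    show "\<forall>x\<in>W. f differentiable (at x)" using Suc.prems by simp
    fix v
    show "Ck_on k (\<lambda>x. frechet_derivative f (at x) v) W"
      by (rule Suc.IH) (use Suc.prems in simp)
  qed
qed

lemma Ck_on_const: "Ck_on k (\<lambda>x. c) W"
  by (induction k arbitrary: c) (auto intro: continuous_intros)

lemma frechet_derivative_eqI: "(f has_derivative D) (at x) \<Longrightarrow> frechet_derivative f (at x) = D"
  using frechet_derivative_at by metis

lemma frechet_has_derivative:
  "f differentiable (at x) \<Longrightarrow> (f has_derivative frechet_derivative f (at x)) (at x)"
  by (simp add: frechet_derivative_works)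

lemma Ck_on_linear: 
  assumes "bounded_linear f" shows "Ck_on k f W"
proof (cases k)
  case 0
  then show ?thesis by (simp add: assms linear_continuous_on)
next
  case (Suc k')
  have d: "(f has_derivative f) (at x)" for x
    by (rule bounded_linear_imp_has_derivative[OF assms])
  show ?thesis
    using d by (auto simp: Suc frechet_derivative_eqI[OF d] Ck_on_const differentiable_def)
qed

lemma Ck_on_linear_comp:
  assumes "bounded_linear L" "open W" "Ck_on k f W"
  shows "Ck_on k (\<lambda>x. L (f x)) W"
  using assms(3)
proof (induction k arbitrary: f)
  case 0
  then show ?case
    using bounded_linear.continuous_on[OF assms(1)] by auto
next
  case (Suc k)
  have d: "((\<lambda>x. L (f x)) has_derivative (\<lambda>v. L (frechet_derivative f (at x) v))) (at x)"
    if "x \<in> W" for x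
    using Suc.prems that by (intro bounded_linear.has_derivative[OF assms(1)] frechet_has_derivative) auto
  have "Ck_on k (\<lambda>x. frechet_derivative (\<lambda>x. L (f x)) (at x) v) W" for v
  proof (subst Ck_on_cong[OF assms(2)])
    show "Ck_on k (\<lambda>x. L (frechet_derivative f (at x) v)) W"
      by (rule Suc.IH) (use Suc.prems in simp)
  qed (simp add: frechet_derivative_eqI[OF d])
  then show ?case using d by (auto simp: differentiable_def)
qed

lemma Ck_on_add:
  assumes "open W" "Ck_on k f W" "Ck_on k g W"
  shows "Ck_on k (\<lambda>x. f x + g x) W"
  using assms(2,3)
proof (induction k arbitrary: f g)
  case 0
  then show ?case by (auto intro: continuous_intros)
next
  case (Suc k)
  have d: "((\<lambda>x. f x + g x) has_derivative
      (\<lambda>v. frechet_derivative f (at x) v + frechet_derivative g (at x) v)) (at x)"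
    if "x \<in> W" for x
    using Suc.prems that by (intro has_derivative_add frechet_has_derivative) auto
  have "Ck_on k (\<lambda>x. frechet_derivative (\<lambda>x. f x + g x) (at x) v) W" for v
  proof (subst Ck_on_cong[OF assms(1)])
    show "Ck_on k (\<lambda>x. frechet_derivative f (at x) v + frechet_derivative g (at x) v) W"
      by (rule Suc.IH) (use Suc.prems in simp_all)
  qed (simp add: frechet_derivative_eqI[OF d])
  then show ?case using d by (auto simp: differentiable_def)
qed

lemma Ck_on_sum:
  assumes "open W" "\<And>i. i \<in> I \<Longrightarrow> Ck_on k (f i) W"
  shows "Ck_on k (\<lambda>x. \<Sum>i\<in>I. f i x) W"
  using assms(2)
  by (induction I rule: infinite_finite_induct) (auto intro: Ck_on_const Ck_on_add[OF assms(1)])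

lemma Ck_on_bilinear:
  assumes "bounded_bilinear B" "open W" "Ck_on k f W" "Ck_on k g W"
  shows "Ck_on k (\<lambda>x. B (f x) (g x)) W"
  using assms(3,4)
proof (induction k arbitrary: f g)
  case 0
  then show ?case
    using bounded_bilinear.continuous_on[OF assms(1)] by auto
next
  case (Suc k)
  have d: "((\<lambda>x. B (f x) (g x)) has_derivative
      (\<lambda>v. B (f x) (frechet_derivative g (at x) v) + B (frechet_derivative f (at x) v) (g x))) (at x)"
    if "x \<in> W" for x
    using Suc.prems that by (intro bounded_bilinear.FDERIV[OF assms(1)] frechet_has_derivative) auto
  have "Ck_on k (\<lambda>x. frechet_derivative (\<lambda>x. B (f x) (g x)) (at x) v) W" for v
  proof (subst Ck_on_cong[OF assms(2)])
    show "Ck_on k (\<lambda>x. B (f x) (frechet_derivative g (at x) v) +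
        B (frechet_derivative f (at x) v) (g x)) W"
      using Suc.prems Ck_on_Suc_imp[OF Suc.prems(1)] Ck_on_Suc_imp[OF Suc.prems(2)]
      by (intro Ck_on_add[OF assms(2)] Suc.IH) simp_all
  qed (simp add: frechet_derivative_eqI[OF d])
  then show ?case using d by (auto simp: differentiable_def)
qed

lemma Ck_on_frechet_derivative:
  assumes "open W" "Ck_on (Suc k) F W" "Ck_on k G W"
  shows "Ck_on k (\<lambda>x. frechet_derivative F (at x) (G x)) W"
proof (subst Ck_on_cong[OF assms(1)])
  fix x assume x: "x \<in> W"
  have lin: "linear (frechet_derivative F (at x))"
    using assms(2) x by (intro linear_frechet_derivative) simp
  have "frechet_derivative F (at x) (G x) =
      frechet_derivative F (at x) (\<Sum>b\<in>Basis. (G x \<bullet> b) *\<^sub>R b)"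
    by (simp add: euclidean_representation)
  also have "\<dots> = (\<Sum>b\<in>Basis. (G x \<bullet> b) *\<^sub>R frechet_derivative F (at x) b)"
    by (simp add: linear_sum[OF lin] linear_scale[OF lin])
  finally show "frechet_derivative F (at x) (G x) =
      (\<Sum>b\<in>Basis. (G x \<bullet> b) *\<^sub>R frechet_derivative F (at x) b)" .
next
  show "Ck_on k (\<lambda>x. \<Sum>b\<in>Basis. (G x \<bullet> b) *\<^sub>R frechet_derivative F (at x) b) W"
    using assms(2)
    by (intro Ck_on_sum[OF assms(1)] Ck_on_bilinear[OF bounded_bilinear_scaleR assms(1)]
        Ck_on_linear_comp[OF bounded_linear_inner_left assms(1)] assms(3)) simp
qed

text \<open>
  By the mean value theorem, applied twice, the second difference
  \<open>f (x + h v + h w) - f (x + h v) - f (x + h w) + f x\<close> is \<open>h\<^sup>2\<close> times a value of the second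
  derivative near \<open>x\<close>; it is symmetric in \<open>v\<close> and \<open>w\<close>.
\<close>

lemma second_difference_mean_value:
  fixes f :: "'a::euclidean_space \<Rightarrow> real"
  assumes C: "Ck_on 2 f (ball x r)" and "0 < h" "h * (norm v + norm w) < r"
  shows "\<exists>y. dist x y \<le> h * (norm v + norm w) \<and>
    f (x + h *\<^sub>R v + h *\<^sub>R w) - f (x + h *\<^sub>R v) - f (x + h *\<^sub>R w) + f x =
    h * (h * frechet_derivative (\<lambda>y. frechet_derivative f (at y) v) (at y) w)"
proof -
  define g where "g y = frechet_derivative f (at y) v" for y
  have near: "dist x (x + a *\<^sub>R v + b *\<^sub>R w) \<le> h * (norm v + norm w)"
    if "0 \<le> a" "a \<le> h" "0 \<le> b" "b \<le> h" for a b
  proof -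
    have "norm (a *\<^sub>R v + b *\<^sub>R w) \<le> a * norm v + b * norm w"
      using norm_triangle_ineq[of "a *\<^sub>R v" "b *\<^sub>R w"] that by simp
    also have "\<dots> \<le> h * norm v + h * norm w"
      using that by (intro add_mono mult_right_mono) auto
    finally show ?thesis by (simp add: dist_norm algebra_simps norm_minus_commute)
  qed
  then have inb: "x + a *\<^sub>R v + b *\<^sub>R w \<in> ball x r"
    if "0 \<le> a" "a \<le> h" "0 \<le> b" "b \<le> h" for a b
    using that assms(3) by fastforce
  have df: "(f has_derivative frechet_derivative f (at y)) (at y)"
    and dg: "(g has_derivative frechet_derivative g (at y)) (at y)" if "y \<in> ball x r" for y
    using C that unfolding g_def numeral_2_eq_2
    by (auto intro!: frechet_has_derivative simp del: mem_ball)
  have Df: "((\<lambda>a. f (x + a *\<^sub>R v + b *\<^sub>R w)) has_real_derivative g (x + a *\<^sub>R v + b *\<^sub>R w)) (at a)"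
    if "0 \<le> a" "a \<le> h" "0 \<le> b" "b \<le> h" for a b
  proof -
    have "((\<lambda>a. f (x + a *\<^sub>R v + b *\<^sub>R w)) has_derivative
        (\<lambda>s. frechet_derivative f (at (x + a *\<^sub>R v + b *\<^sub>R w)) (s *\<^sub>R v))) (at a)"
      by (rule has_derivative_compose[where g = f and f = "\<lambda>a. x + a *\<^sub>R v + b *\<^sub>R w", OF _ df[OF inb[OF that]]]) (auto intro!: derivative_eq_intros)
    moreover have "frechet_derivative f (at (x + a *\<^sub>R v + b *\<^sub>R w)) (s *\<^sub>R v) =
        g (x + a *\<^sub>R v + b *\<^sub>R w) * s" for s
      using linear_scale[OF has_derivative_linear[OF df[OF inb[OF that]]]] by (simp add: g_def)
    ultimately show ?thesis by (simp add: has_field_derivative_def)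
  qed
  have Dg: "((\<lambda>b. g (x + a *\<^sub>R v + b *\<^sub>R w)) has_real_derivative
      frechet_derivative g (at (x + a *\<^sub>R v + b *\<^sub>R w)) w) (at b)"
    if "0 \<le> a" "a \<le> h" "0 \<le> b" "b \<le> h" for a b
  proof -
    have "((\<lambda>b. g (x + a *\<^sub>R v + b *\<^sub>R w)) has_derivative
        (\<lambda>s. frechet_derivative g (at (x + a *\<^sub>R v + b *\<^sub>R w)) (s *\<^sub>R w))) (at b)"
      by (rule has_derivative_compose[where g = g and f = "\<lambda>b. x + a *\<^sub>R v + b *\<^sub>R w", OF _ dg[OF inb[OF that]]]) (auto intro!: derivative_eq_intros)
    moreover have "frechet_derivative g (at (x + a *\<^sub>R v + b *\<^sub>R w)) (s *\<^sub>R w) =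
        frechet_derivative g (at (x + a *\<^sub>R v + b *\<^sub>R w)) w * s" for s
      using linear_scale[OF has_derivative_linear[OF dg[OF inb[OF that]]]] by simp
    ultimately show ?thesis by (simp add: has_field_derivative_def)
  qed
  have "\<exists>a. 0 < a \<and> a < h \<and>
      (f (x + h *\<^sub>R v + h *\<^sub>R w) - f (x + h *\<^sub>R v + 0 *\<^sub>R w)) -
      (f (x + 0 *\<^sub>R v + h *\<^sub>R w) - f (x + 0 *\<^sub>R v + 0 *\<^sub>R w)) =
      (h - 0) * (g (x + a *\<^sub>R v + h *\<^sub>R w) - g (x + a *\<^sub>R v + 0 *\<^sub>R w))"
    by (rule MVT2[OF \<open>0 < h\<close>]) (intro DERIV_diff Df; use \<open>0 < h\<close> in simp)
  then obtain a where a: "0 < a" "a < h"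
    "f (x + h *\<^sub>R v + h *\<^sub>R w) - f (x + h *\<^sub>R v) - f (x + h *\<^sub>R w) + f x =
      h * (g (x + a *\<^sub>R v + h *\<^sub>R w) - g (x + a *\<^sub>R v))"
    by (auto simp: algebra_simps)
  have "\<exists>b. 0 < b \<and> b < h \<and>
      g (x + a *\<^sub>R v + h *\<^sub>R w) - g (x + a *\<^sub>R v + 0 *\<^sub>R w) =
      (h - 0) * frechet_derivative g (at (x + a *\<^sub>R v + b *\<^sub>R w)) w"
    by (rule MVT2[OF \<open>0 < h\<close>]) (intro Dg; use a in simp)
  then obtain b where b: "0 < b" "b < h"
      "g (x + a *\<^sub>R v + h *\<^sub>R w) - g (x + a *\<^sub>R v) =
      h * frechet_derivative g (at (x + a *\<^sub>R v + b *\<^sub>R w)) w"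
    by auto
  have "dist x (x + a *\<^sub>R v + b *\<^sub>R w) \<le> h * (norm v + norm w)"
    using a b by (intro near) auto
  moreover have "f (x + h *\<^sub>R v + h *\<^sub>R w) - f (x + h *\<^sub>R v) - f (x + h *\<^sub>R w) + f x =
    h * (h * frechet_derivative g (at (x + a *\<^sub>R v + b *\<^sub>R w)) w)"
    using a(3) b(3) by simp
  ultimately show ?thesis
    unfolding g_def by blast
qed

lemma second_derivative_symmetric_real:
  fixes f :: "'a::euclidean_space \<Rightarrow> real"
  assumes "open W" "x \<in> W" "Ck_on 2 f W"
  shows "frechet_derivative (\<lambda>y. frechet_derivative f (at y) v) (at x) w =
    frechet_derivative (\<lambda>y. frechet_derivative f (at y) w) (at x) v"
proof -
  define P where "P y = frechet_derivative (\<lambda>y. frechet_derivative f (at y) v) (at y) w" for y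
  define Q where "Q y = frechet_derivative (\<lambda>y. frechet_derivative f (at y) w) (at y) v" for y
  have "continuous_on W P" "continuous_on W Q"
    using assms(3) by (simp_all add: P_def Q_def numeral_2_eq_2)
  then have PQ: "isCont P x" "isCont Q x"
    using assms continuous_on_eq_continuous_at by blast+
  obtain r0 where r0: "r0 > 0" "ball x r0 \<subseteq> W"
    using assms openE by blast
  have "\<bar>P x - Q x\<bar> \<le> 0 + e" if "e > 0" for e
  proof -
    have e2: "e / 2 > 0" using that by simp
    obtain d1 where d1: "d1 > 0" "\<And>y. dist y x < d1 \<Longrightarrow> dist (P y) (P x) < e / 2"
      using PQ(1) e2 unfolding continuous_at_eps_delta by blast
    obtain d2 where d2: "d2 > 0" "\<And>y. dist y x < d2 \<Longrightarrow> dist (Q y) (Q x) < e / 2"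
      using PQ(2) e2 unfolding continuous_at_eps_delta by blast
    define r where "r = min r0 (min d1 d2)"
    have r: "r > 0" "r \<le> r0" "r \<le> d1" "r \<le> d2" using r0 d1 d2 by (auto simp: r_def)
    define h where "h = r / (norm v + norm w + 1)"
    have n: "norm v + norm w + 1 > 0" by (simp add: add_nonneg_pos)
    have h: "h > 0" using r n by (simp add: h_def)
    have "h * (norm v + norm w) < h * (norm v + norm w + 1)" using h by (intro mult_strict_left_mono) auto
    also have "\<dots> = r" using n by (simp add: h_def)
    finally have hr: "h * (norm v + norm w) < r" .
    then have hr': "h * (norm w + norm v) < r" by (simp add: add.commute)
    have C: "Ck_on 2 f (ball x r)"
      using r0 r by (intro Ck_on_subset[OF assms(3)]) auto
    obtain y where y: "dist x y \<le> h * (norm v + norm w)"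
      "f (x + h *\<^sub>R v + h *\<^sub>R w) - f (x + h *\<^sub>R v) - f (x + h *\<^sub>R w) + f x = h * (h * P y)"
      using second_difference_mean_value[OF C h hr] unfolding P_def by blast
    obtain z where z: "dist x z \<le> h * (norm w + norm v)"
      "f (x + h *\<^sub>R w + h *\<^sub>R v) - f (x + h *\<^sub>R w) - f (x + h *\<^sub>R v) + f x = h * (h * Q z)"
      using second_difference_mean_value[OF C h hr'] unfolding Q_def by blast
    have swap: "x + h *\<^sub>R w + h *\<^sub>R v = x + h *\<^sub>R v + h *\<^sub>R w" by simp
    have "h * (h * P y) = h * (h * Q z)" using y(2) z(2) unfolding swap by linarith
    then have "P y = Q z" using \<open>h > 0\<close> by (metis mult_left_cancel less_irrefl)
    moreover have "dist (P y) (P x) < e / 2" using y(1) hr r(3) by (intro d1(2)) (simp add: dist_commute)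
    moreover have "dist (Q z) (Q x) < e / 2" using z(1) hr' r(4) by (intro d2(2)) (simp add: dist_commute)
    ultimately show ?thesis unfolding dist_real_def by arith
  qed
  then have "\<bar>P x - Q x\<bar> \<le> 0" by (rule field_le_epsilon)
  then show ?thesis by (simp add: P_def Q_def)
qed

lemma second_derivative_symmetric:
  fixes f :: "'a::euclidean_space \<Rightarrow> 'b::euclidean_space"
  assumes "open W" "x \<in> W" "Ck_on 2 f W"
  shows "frechet_derivative (\<lambda>y. frechet_derivative f (at y) v) (at x) w =
    frechet_derivative (\<lambda>y. frechet_derivative f (at y) w) (at x) v"
proof (rule euclidean_eqI)
  fix b :: 'b
  have C: "Ck_on 2 (\<lambda>y. f y \<bullet> b) W"
    by (rule Ck_on_linear_comp[OF bounded_linear_inner_left assms(1,3)])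
  have 1: "frechet_derivative (\<lambda>y. f y \<bullet> b) (at y) u = frechet_derivative f (at y) u \<bullet> b"
    if "y \<in> W" for y u
  proof -
    have "((\<lambda>y. f y \<bullet> b) has_derivative (\<lambda>u. frechet_derivative f (at y) u \<bullet> b)) (at y)"
      using assms(3) that unfolding numeral_2_eq_2
      by (intro bounded_linear.has_derivative[OF bounded_linear_inner_left] frechet_has_derivative) simp
    then show ?thesis using frechet_derivative_eqI by metis
  qed
  have 2: "frechet_derivative (\<lambda>y. frechet_derivative (\<lambda>y. f y \<bullet> b) (at y) u) (at x) u' =
    frechet_derivative (\<lambda>y. frechet_derivative f (at y) u) (at x) u' \<bullet> b" for u u'
  proof -
    have "((\<lambda>y. frechet_derivative f (at y) u \<bullet> b) has_derivative
        (\<lambda>u'. frechet_derivative (\<lambda>y. frechet_derivative f (at y) u) (at x) u' \<bullet> b)) (at x)"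
      using assms unfolding numeral_2_eq_2
      by (intro bounded_linear.has_derivative[OF bounded_linear_inner_left] frechet_has_derivative) simp
    then have "((\<lambda>y. frechet_derivative (\<lambda>y. f y \<bullet> b) (at y) u) has_derivative
        (\<lambda>u'. frechet_derivative (\<lambda>y. frechet_derivative f (at y) u) (at x) u' \<bullet> b)) (at x)"
      by (rule has_derivative_transform_within_open[OF _ assms(1,2)]) (simp add: 1)
    then show ?thesis using frechet_derivative_eqI by metis
  qed
  show "frechet_derivative (\<lambda>y. frechet_derivative f (at y) v) (at x) w \<bullet> b =
    frechet_derivative (\<lambda>y. frechet_derivative f (at y) w) (at x) v \<bullet> b"
    using second_derivative_symmetric_real[OF assms(1,2) C, of v w] unfolding 2 .
qed

section \<open>Directional derivatives and connections on a submanifold\<close>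

lemma smooth_on_extension:
  assumes "smooth_on S f" "x \<in> S"
  obtains W F where "open W" "x \<in> W" "\<forall>k. Ck_on k F W" "\<forall>y\<in>S \<inter> W. F y = f y"
  using assms unfolding smooth_on_def by blast

lemma smooth_on_cong:
  assumes "\<And>x. x \<in> S \<Longrightarrow> f x = g x"
  shows "smooth_on S f \<longleftrightarrow> smooth_on S g"
  unfolding smooth_on_def using assms by (metis IntE)

lemma smooth_onI:
  assumes "\<And>k. Ck_on k f UNIV"
  shows "smooth_on S f"
  unfolding smooth_on_def using assms open_UNIV by blast

lemma smooth_on_const: "smooth_on S (\<lambda>x. c)"
  by (intro smooth_onI Ck_on_const)

lemma smooth_on_linear: "bounded_linear L \<Longrightarrow> smooth_on S L"
  by (intro smooth_onI Ck_on_linear)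

lemma smooth_on_ident: "smooth_on S (\<lambda>x. x)"
  by (intro smooth_on_linear bounded_linear_ident)

lemma smooth_on_bilinear:
  assumes B: "bounded_bilinear B" and "smooth_on S f" "smooth_on S g"
  shows "smooth_on S (\<lambda>x. B (f x) (g x))"
  unfolding smooth_on_def
proof
  fix x assume x: "x \<in> S"
  obtain W F where F: "open W" "x \<in> W" "\<forall>k. Ck_on k F W" "\<forall>y\<in>S \<inter> W. F y = f y"
    using smooth_on_extension[OF assms(2) x] .
  obtain V G where G: "open V" "x \<in> V" "\<forall>k. Ck_on k G V" "\<forall>y\<in>S \<inter> V. G y = g y"
    using smooth_on_extension[OF assms(3) x] .
  have "open (W \<inter> V)" using F G by blast
  moreover have "Ck_on k (\<lambda>y. B (F y) (G y)) (W \<inter> V)" for k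
    using F(3) G(3) by (intro Ck_on_bilinear[OF B \<open>open (W \<inter> V)\<close>]) (auto intro: Ck_on_subset)
  ultimately show "\<exists>W H. open W \<and> x \<in> W \<and> (\<forall>k. Ck_on k H W) \<and>
      (\<forall>y\<in>S \<inter> W. H y = B (f y) (g y))"
    using F G by (intro exI[of _ "W \<inter> V"] exI[of _ "\<lambda>y. B (F y) (G y)"]) auto
qed

lemma smooth_on_scaleR:
  "smooth_on S f \<Longrightarrow> smooth_on S g \<Longrightarrow> smooth_on S (\<lambda>x. f x *\<^sub>R g x)"
  by (rule smooth_on_bilinear[OF bounded_bilinear_scaleR])

lemma smooth_on_linear_comp:
  assumes L: "bounded_linear L" and "smooth_on S f"
  shows "smooth_on S (\<lambda>x. L (f x))"
  unfolding smooth_on_def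
proof
  fix x assume x: "x \<in> S"
  obtain W F where F: "open W" "x \<in> W" "\<forall>k. Ck_on k F W" "\<forall>y\<in>S \<inter> W. F y = f y"
    using smooth_on_extension[OF assms(2) x] .
  then show "\<exists>W H. open W \<and> x \<in> W \<and> (\<forall>k. Ck_on k H W) \<and> (\<forall>y\<in>S \<inter> W. H y = L (f y))"
    using Ck_on_linear_comp[OF L F(1)]
    by (intro exI[of _ W] exI[of _ "\<lambda>y. L (F y)"]) auto
qed

lemma smooth_on_add:
  assumes "smooth_on S f" "smooth_on S g"
  shows "smooth_on S (\<lambda>x. f x + g x)"
  unfolding smooth_on_def
proof
  fix x assume x: "x \<in> S"
  obtain W F where F: "open W" "x \<in> W" "\<forall>k. Ck_on k F W" "\<forall>y\<in>S \<inter> W. F y = f y"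
    using smooth_on_extension[OF assms(1) x] .
  obtain V G where G: "open V" "x \<in> V" "\<forall>k. Ck_on k G V" "\<forall>y\<in>S \<inter> V. G y = g y"
    using smooth_on_extension[OF assms(2) x] .
  have "open (W \<inter> V)" using F G by blast
  moreover have "Ck_on k (\<lambda>y. F y + G y) (W \<inter> V)" for k
    using F(3) G(3) by (intro Ck_on_add[OF \<open>open (W \<inter> V)\<close>]) (auto intro: Ck_on_subset)
  ultimately show "\<exists>W H. open W \<and> x \<in> W \<and> (\<forall>k. Ck_on k H W) \<and>
      (\<forall>y\<in>S \<inter> W. H y = f y + g y)"
    using F G by (intro exI[of _ "W \<inter> V"] exI[of _ "\<lambda>y. F y + G y"]) auto
qed

lemma smooth_on_scaleR_const: "smooth_on S f \<Longrightarrow> smooth_on S (\<lambda>x. c *\<^sub>R f x)"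
  by (rule smooth_on_linear_comp[OF bounded_linear_scaleR_right])

lemma smooth_on_minus: "smooth_on S f \<Longrightarrow> smooth_on S (\<lambda>x. - f x)"
  by (rule smooth_on_linear_comp[OF bounded_linear_minus[OF bounded_linear_ident]])

lemma smooth_on_diff:
  "smooth_on S f \<Longrightarrow> smooth_on S g \<Longrightarrow> smooth_on S (\<lambda>x. f x - g x)"
  using smooth_on_add[OF _ smooth_on_minus] by fastforce

lemmas smooth_intros = smooth_on_const smooth_on_ident smooth_on_scaleR_const smooth_on_add
  smooth_on_minus smooth_on_diff

lemma vector_field_cong:
  assumes "\<And>x. x \<in> S \<Longrightarrow> V x = W x"
  shows "vector_field S Tan V \<longleftrightarrow> vector_field S Tan W"
  unfolding vector_field_def using smooth_on_cong[of S V W, OF assms] by (auto simp: assms)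

lemma dir_deriv_cong:
  assumes "\<And>y. y \<in> S \<Longrightarrow> f y = g y"
  shows "dir_deriv S f x v = dir_deriv S g x v"
proof -
  have "(\<lambda>s. f (\<gamma> s)) = (\<lambda>s. g (\<gamma> s))" if "\<forall>s. \<gamma> s \<in> S" for \<gamma> :: "real \<Rightarrow> 'a"
    using assms that by auto
  then have "(\<forall>\<gamma> :: real \<Rightarrow> 'a. (\<forall>s. \<gamma> s \<in> S) \<and> \<gamma> 0 = x \<and> (\<gamma> has_vector_derivative v) (at 0) \<longrightarrow>
      ((\<lambda>s. f (\<gamma> s)) has_vector_derivative d) (at 0)) \<longleftrightarrow>
    (\<forall>\<gamma> :: real \<Rightarrow> 'a. (\<forall>s. \<gamma> s \<in> S) \<and> \<gamma> 0 = x \<and> (\<gamma> has_vector_derivative v) (at 0) \<longrightarrow>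
      ((\<lambda>s. g (\<gamma> s)) has_vector_derivative d) (at 0))" for d
    by metis
  then show ?thesis unfolding dir_deriv_def by simp
qed

lemma affine_connection_vector_field:
  "affine_connection S Tan nab \<Longrightarrow> vector_field S Tan V \<Longrightarrow> vector_field S Tan Z \<Longrightarrow>
    vector_field S Tan (nab V Z)"
  by (simp add: affine_connection_def)

lemma affine_connection_unfold:
  assumes "affine_connection S Tan nab" "vector_field S Tan V" "vector_field S Tan Z" "x \<in> S"
  shows "vector_field S Tan W \<Longrightarrow> nab (\<lambda>y. V y + W y) Z x = nab V Z x + nab W Z x"
    and "vector_field S Tan W \<Longrightarrow> nab V (\<lambda>y. W y + Z y) x = nab V W x + nab V Z x"
    and "smooth_on S f \<Longrightarrow> nab (\<lambda>y. f y *\<^sub>R V y) Z x = f x *\<^sub>R nab V Z x"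
    and "smooth_on S f \<Longrightarrow> nab V (\<lambda>y. f y *\<^sub>R Z y) x =
      dir_deriv S f x (V x) *\<^sub>R Z x + f x *\<^sub>R nab V Z x"
  using assms by (simp_all add: affine_connection_def)

lemma levi_civita_unfold:
  assumes "levi_civita S Tan g nab" "vector_field S Tan V" "vector_field S Tan Z"
  shows "vector_field S Tan (nab V Z)"
    and "x \<in> S \<Longrightarrow> nab V Z x - nab Z V x = lie_bracket S V Z x"
    and "x \<in> S \<Longrightarrow> vector_field S Tan W \<Longrightarrow> dir_deriv S (\<lambda>y. g y (W y) (Z y)) x (V x) =
           g x (nab V W x) (Z x) + g x (W x) (nab V Z x)"
  using assms by (auto simp: levi_civita_def affine_connection_vector_field)

locale velocity_curves =
  fixes S :: "'a::euclidean_space set" and Tan :: "'a \<Rightarrow> 'a set"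
  assumes subspace_Tan: "x \<in> S \<Longrightarrow> subspace (Tan x)"
    and curve_exists: "x \<in> S \<Longrightarrow> v \<in> Tan x \<Longrightarrow>
      \<exists>\<gamma> :: real \<Rightarrow> 'a. (\<forall>s. \<gamma> s \<in> S) \<and> \<gamma> 0 = x \<and> (\<gamma> has_vector_derivative v) (at 0)"
begin

lemma vector_field_add:
  "vector_field S Tan V \<Longrightarrow> vector_field S Tan W \<Longrightarrow> vector_field S Tan (\<lambda>x. V x + W x)"
  by (simp add: vector_field_def smooth_on_add subspace_Tan subspace_add)

lemma vector_field_diff:
  "vector_field S Tan V \<Longrightarrow> vector_field S Tan W \<Longrightarrow> vector_field S Tan (\<lambda>x. V x - W x)"
  by (simp add: vector_field_def smooth_on_diff subspace_Tan subspace_diff)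

lemma vector_field_scaleR:
  "smooth_on S f \<Longrightarrow> vector_field S Tan W \<Longrightarrow> vector_field S Tan (\<lambda>x. f x *\<^sub>R W x)"
  by (simp add: vector_field_def smooth_on_scaleR subspace_Tan subspace_scale)

lemma dir_deriv_frechet:
  assumes "x \<in> S" "v \<in> Tan x" "open W" "x \<in> W" "F differentiable (at x)"
    and eq: "\<And>y. y \<in> S \<Longrightarrow> y \<in> W \<Longrightarrow> F y = f y"
  shows "dir_deriv S f x v = frechet_derivative F (at x) v"
proof -
  define D where "D = frechet_derivative F (at x)"
  have D: "(F has_derivative D) (at x)"
    unfolding D_def by (rule frechet_has_derivative[OF assms(5)])
  have deriv: "((\<lambda>s. f (\<gamma> s)) has_vector_derivative D v) (at 0)"
    if "\<forall>s. \<gamma> s \<in> S" "\<gamma> 0 = x" "(\<gamma> has_vector_derivative v) (at 0)" for \<gamma> :: "real \<Rightarrow> 'a"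
  proof -
    have g: "(\<gamma> has_derivative (\<lambda>s. s *\<^sub>R v)) (at 0)"
      using that(3) by (simp add: has_vector_derivative_def)
    have D': "(F has_derivative D) (at (\<gamma> 0))" using D that by simp
    have "((\<lambda>s. F (\<gamma> s)) has_derivative (\<lambda>s. D (s *\<^sub>R v))) (at 0)"
      by (rule has_derivative_compose[where g = F, OF g D'])
    then have F: "((\<lambda>s. F (\<gamma> s)) has_vector_derivative D v) (at 0)"
      by (simp add: has_vector_derivative_def linear_scale[OF has_derivative_linear[OF D]])
    have "isCont \<gamma> 0" using g has_derivative_continuous by blast
    then have "\<forall>\<^sub>F s in at 0. \<gamma> s \<in> W"
      using assms(3,4) that(2) unfolding continuous_at by (metis topological_tendstoD)
    then have "\<forall>\<^sub>F s in at 0. F (\<gamma> s) = f (\<gamma> s)"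
      by (rule eventually_mono) (use eq that in auto)
    moreover have "F (\<gamma> 0) = f (\<gamma> 0)" using eq assms that by auto
    ultimately show ?thesis
      using F unfolding has_vector_derivative_def
      by (intro has_derivative_transform_eventually[where f = "\<lambda>s. F (\<gamma> s)" and g = "\<lambda>s. f (\<gamma> s)"]) auto
  qed
  obtain \<gamma> :: "real \<Rightarrow> 'a" where \<gamma>: "\<forall>s. \<gamma> s \<in> S" "\<gamma> 0 = x" "(\<gamma> has_vector_derivative v) (at 0)"
    using curve_exists[OF assms(1,2)] by blast
  show ?thesis
    unfolding dir_deriv_def D_def[symmetric]
  proof (rule the_equality)
    show "\<forall>\<gamma>. (\<forall>s. \<gamma> s \<in> S) \<and> \<gamma> 0 = x \<and> (\<gamma> has_vector_derivative v) (at 0) \<longrightarrow>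
        ((\<lambda>s. f (\<gamma> s)) has_vector_derivative D v) (at 0)"
      using deriv by blast
    fix d
    assume "\<forall>\<gamma>. (\<forall>s. \<gamma> s \<in> S) \<and> \<gamma> 0 = x \<and> (\<gamma> has_vector_derivative v) (at 0) \<longrightarrow>
        ((\<lambda>s. f (\<gamma> s)) has_vector_derivative d) (at 0)"
    then have "((\<lambda>s. f (\<gamma> s)) has_vector_derivative d) (at 0)" using \<gamma> by blast
    then show "d = D v" using deriv[OF \<gamma>] vector_derivative_unique_at by blast
  qed
qed

lemma Ck_on_differentiable: "(\<forall>k. Ck_on k F W) \<Longrightarrow> y \<in> W \<Longrightarrow> F differentiable (at y)"
  using Ck_on.simps(2) by blast

lemma dir_deriv_smooth:
  assumes "x \<in> S" "smooth_on S f"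
  obtains W F where "open W" "x \<in> W" "\<forall>k. Ck_on k F W"
    "\<forall>y\<in>S \<inter> W. F y = f y"
    "\<forall>y\<in>S \<inter> W. \<forall>v\<in>Tan y. dir_deriv S f y v = frechet_derivative F (at y) v"
proof -
  obtain W F where F: "open W" "x \<in> W" "\<forall>k. Ck_on k F W" "\<forall>y\<in>S \<inter> W. F y = f y"
    using smooth_on_extension[OF assms(2,1)] .
  have "\<forall>y\<in>S \<inter> W. \<forall>v\<in>Tan y. dir_deriv S f y v = frechet_derivative F (at y) v"
    using F Ck_on_differentiable[OF F(3)] by (intro ballI dir_deriv_frechet[where W = W]) auto
  with F show thesis by (rule that)
qed

lemma dir_deriv_add_right:
  assumes "x \<in> S" "smooth_on S f" "v \<in> Tan x" "w \<in> Tan x"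
  shows "dir_deriv S f x (v + w) = dir_deriv S f x v + dir_deriv S f x w"
proof -
  obtain W F where F: "open W" "x \<in> W" "\<forall>k. Ck_on k F W"
    "\<forall>y\<in>S \<inter> W. F y = f y"
    "\<forall>y\<in>S \<inter> W. \<forall>v\<in>Tan y. dir_deriv S f y v = frechet_derivative F (at y) v"
    using dir_deriv_smooth[OF assms(1,2)] .
  show ?thesis
    using linear_add[OF linear_frechet_derivative[OF Ck_on_differentiable[OF F(3,2)]]] assms F(2)
    by (simp add: F(5) subspace_Tan subspace_add)
qed

lemma dir_deriv_scaleR_right:
  assumes "x \<in> S" "smooth_on S f" "v \<in> Tan x"
  shows "dir_deriv S f x (c *\<^sub>R v) = c *\<^sub>R dir_deriv S f x v"
proof -
  obtain W F where F: "open W" "x \<in> W" "\<forall>k. Ck_on k F W"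
    "\<forall>y\<in>S \<inter> W. F y = f y"
    "\<forall>y\<in>S \<inter> W. \<forall>v\<in>Tan y. dir_deriv S f y v = frechet_derivative F (at y) v"
    using dir_deriv_smooth[OF assms(1,2)] .
  show ?thesis
    using linear_scale[OF linear_frechet_derivative[OF Ck_on_differentiable[OF F(3,2)]]] assms F(2)
    by (simp add: F(5) subspace_Tan subspace_scale)
qed

lemma dir_deriv_bilinear:
  assumes B: "bounded_bilinear B" and "x \<in> S" "v \<in> Tan x" "smooth_on S f" "smooth_on S g"
  shows "dir_deriv S (\<lambda>y. B (f y) (g y)) x v =
    B (f x) (dir_deriv S g x v) + B (dir_deriv S f x v) (g x)"
proof -
  obtain W F where F: "open W" "x \<in> W" "\<forall>k. Ck_on k F W"
    "\<forall>y\<in>S \<inter> W. F y = f y"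
    "\<forall>y\<in>S \<inter> W. \<forall>v\<in>Tan y. dir_deriv S f y v = frechet_derivative F (at y) v"
    using dir_deriv_smooth[OF assms(2,4)] .
  obtain V G where G: "open V" "x \<in> V" "\<forall>k. Ck_on k G V"
    "\<forall>y\<in>S \<inter> V. G y = g y"
    "\<forall>y\<in>S \<inter> V. \<forall>v\<in>Tan y. dir_deriv S g y v = frechet_derivative G (at y) v"
    using dir_deriv_smooth[OF assms(2,5)] .
  have d: "((\<lambda>x. B (F x) (G x)) has_derivative
      (\<lambda>v. B (F x) (frechet_derivative G (at x) v) + B (frechet_derivative F (at x) v) (G x))) (at x)"
    using F(2) G(2)
    by (intro bounded_bilinear.FDERIV[OF B] frechet_has_derivative Ck_on_differentiable[OF F(3)] Ck_on_differentiable[OF G(3)])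
  have "dir_deriv S (\<lambda>y. B (f y) (g y)) x v = frechet_derivative (\<lambda>y. B (F y) (G y)) (at x) v"
    using F G assms d by (intro dir_deriv_frechet[of _ _ "W \<inter> V"]) (auto simp: differentiable_def)
  then show ?thesis
    using F G assms by (simp add: frechet_derivative_eqI[OF d])
qed

lemma dir_deriv_linear:
  assumes L: "bounded_linear L" and "x \<in> S" "v \<in> Tan x" "smooth_on S f"
  shows "dir_deriv S (\<lambda>y. L (f y)) x v = L (dir_deriv S f x v)"
proof -
  obtain W F where F: "open W" "x \<in> W" "\<forall>k. Ck_on k F W"
    "\<forall>y\<in>S \<inter> W. F y = f y"
    "\<forall>y\<in>S \<inter> W. \<forall>v\<in>Tan y. dir_deriv S f y v = frechet_derivative F (at y) v"
    using dir_deriv_smooth[OF assms(2,4)] .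
  have d: "((\<lambda>x. L (F x)) has_derivative (\<lambda>v. L (frechet_derivative F (at x) v))) (at x)"
    using F(2)
    by (intro bounded_linear.has_derivative[OF L] frechet_has_derivative Ck_on_differentiable[OF F(3)])
  have "dir_deriv S (\<lambda>y. L (f y)) x v = frechet_derivative (\<lambda>y. L (F y)) (at x) v"
    using F assms d by (intro dir_deriv_frechet[of _ _ W]) (auto simp: differentiable_def)
  then show ?thesis
    using F assms by (simp add: frechet_derivative_eqI[OF d])
qed

lemma dir_deriv_add:
  assumes "x \<in> S" "v \<in> Tan x" "smooth_on S f" "smooth_on S g"
  shows "dir_deriv S (\<lambda>y. f y + g y) x v = dir_deriv S f x v + dir_deriv S g x v"
proof -
  obtain W F where F: "open W" "x \<in> W" "\<forall>k. Ck_on k F W"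
    "\<forall>y\<in>S \<inter> W. F y = f y"
    "\<forall>y\<in>S \<inter> W. \<forall>v\<in>Tan y. dir_deriv S f y v = frechet_derivative F (at y) v"
    using dir_deriv_smooth[OF assms(1,3)] .
  obtain V G where G: "open V" "x \<in> V" "\<forall>k. Ck_on k G V"
    "\<forall>y\<in>S \<inter> V. G y = g y"
    "\<forall>y\<in>S \<inter> V. \<forall>v\<in>Tan y. dir_deriv S g y v = frechet_derivative G (at y) v"
    using dir_deriv_smooth[OF assms(1,4)] .
  have d: "((\<lambda>x. F x + G x) has_derivative
      (\<lambda>v. frechet_derivative F (at x) v + frechet_derivative G (at x) v)) (at x)"
    using F(2) G(2)
    by (intro has_derivative_add frechet_has_derivative Ck_on_differentiable[OF F(3)] Ck_on_differentiable[OF G(3)])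
  have "dir_deriv S (\<lambda>y. f y + g y) x v = frechet_derivative (\<lambda>y. F y + G y) (at x) v"
    using F G assms d by (intro dir_deriv_frechet[of _ _ "W \<inter> V"]) (auto simp: differentiable_def)
  then show ?thesis
    using F G assms by (simp add: frechet_derivative_eqI[OF d])
qed

lemma dir_deriv_const: "x \<in> S \<Longrightarrow> v \<in> Tan x \<Longrightarrow> dir_deriv S (\<lambda>y. c) x v = 0"
  using dir_deriv_frechet[of x v UNIV "\<lambda>y. c"] by simp

lemma dir_deriv_ident: "x \<in> S \<Longrightarrow> v \<in> Tan x \<Longrightarrow> dir_deriv S (\<lambda>y. y) x v = v"
  using dir_deriv_frechet[of x v UNIV "\<lambda>y. y"] by simp

lemma dir_deriv_minus:
  "x \<in> S \<Longrightarrow> v \<in> Tan x \<Longrightarrow> smooth_on S f \<Longrightarrow> dir_deriv S (\<lambda>y. - f y) x v = - dir_deriv S f x v"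
  by (rule dir_deriv_linear[OF bounded_linear_minus[OF bounded_linear_ident]])

lemma dir_deriv_scaleR_const:
  "x \<in> S \<Longrightarrow> v \<in> Tan x \<Longrightarrow> smooth_on S f \<Longrightarrow> dir_deriv S (\<lambda>y. c *\<^sub>R f y) x v = c *\<^sub>R dir_deriv S f x v"
  by (rule dir_deriv_linear[OF bounded_linear_scaleR_right])

lemma dir_deriv_diff:
  "x \<in> S \<Longrightarrow> v \<in> Tan x \<Longrightarrow> smooth_on S f \<Longrightarrow> smooth_on S g \<Longrightarrow>
    dir_deriv S (\<lambda>y. f y - g y) x v = dir_deriv S f x v - dir_deriv S g x v"
  using dir_deriv_add[of x v f "\<lambda>y. - g y"] by (simp add: smooth_on_minus dir_deriv_minus)

lemma smooth_on_dir_deriv: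
  assumes "vector_field S Tan V" "smooth_on S f"
  shows "smooth_on S (\<lambda>x. dir_deriv S f x (V x))"
  unfolding smooth_on_def
proof
  fix x assume x: "x \<in> S"
  have V: "smooth_on S V" "\<And>y. y \<in> S \<Longrightarrow> V y \<in> Tan y"
    using assms(1) by (auto simp: vector_field_def)
  obtain W F where F: "open W" "x \<in> W" "\<forall>k. Ck_on k F W"
    "\<forall>y\<in>S \<inter> W. F y = f y"
    "\<forall>y\<in>S \<inter> W. \<forall>v\<in>Tan y. dir_deriv S f y v = frechet_derivative F (at y) v"
    using dir_deriv_smooth[OF x assms(2)] .
  obtain X G where G: "open X" "x \<in> X" "\<forall>k. Ck_on k G X" "\<forall>y\<in>S \<inter> X. G y = V y"
    using smooth_on_extension[OF V(1) x] .
  have o: "open (W \<inter> X)" using F G by blast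
  have "Ck_on k (\<lambda>y. frechet_derivative F (at y) (G y)) (W \<inter> X)" for k
    using F(3) G(3) by (intro Ck_on_frechet_derivative[OF o]) (blast intro: Ck_on_subset)+
  then show "\<exists>W H. open W \<and> x \<in> W \<and> (\<forall>k. Ck_on k H W) \<and>
      (\<forall>y\<in>S \<inter> W. H y = dir_deriv S f y (V y))"
    using F G o V(2)
    by (intro exI[of _ "W \<inter> X"] exI[of _ "\<lambda>y. frechet_derivative F (at y) (G y)"]) auto
qed

lemma dir_deriv_commutator:
  assumes X: "vector_field S Tan X" and Y: "vector_field S Tan Y" and Z: "smooth_on S Z"
    and x: "x \<in> S" and br: "lie_bracket S X Y x \<in> Tan x"
  shows "dir_deriv S (\<lambda>y. dir_deriv S Z y (Y y)) x (X x) -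
    dir_deriv S (\<lambda>y. dir_deriv S Z y (X y)) x (Y x) = dir_deriv S Z x (lie_bracket S X Y x)"
proof -
  have sm: "smooth_on S X" "smooth_on S Y" and tan: "\<And>y. y \<in> S \<Longrightarrow> X y \<in> Tan y" "\<And>y. y \<in> S \<Longrightarrow> Y y \<in> Tan y"
    using X Y by (auto simp: vector_field_def)
  obtain W F where F: "open W" "x \<in> W" "\<forall>k. Ck_on k F W"
    "\<forall>y\<in>S \<inter> W. F y = Z y"
    "\<forall>y\<in>S \<inter> W. \<forall>v\<in>Tan y. dir_deriv S Z y v = frechet_derivative F (at y) v"
    using dir_deriv_smooth[OF x Z] .
  define DF where "DF y = frechet_derivative F (at y)" for y
  define D2 where "D2 u v = frechet_derivative (\<lambda>y. DF y u) (at x) v" for u v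
  have lin: "linear (DF y)" if "y \<in> W" for y
    unfolding DF_def by (intro linear_frechet_derivative Ck_on_differentiable[OF F(3) that])
  have second: "dir_deriv S (\<lambda>y. dir_deriv S Z y (V y)) x v =
      D2 (V x) v + DF x (dir_deriv S V x v)"
    if V: "smooth_on S V" and tV: "\<And>y. y \<in> S \<Longrightarrow> V y \<in> Tan y" and v: "v \<in> Tan x" for V v
  proof -
    obtain W' G where G: "open W'" "x \<in> W'" "\<forall>k. Ck_on k G W'"
      "\<forall>y\<in>S \<inter> W'. G y = V y"
      "\<forall>y\<in>S \<inter> W'. \<forall>v\<in>Tan y. dir_deriv S V y v = frechet_derivative G (at y) v"
      using dir_deriv_smooth[OF x V] .
    define DG where "DG = frechet_derivative G (at x)"
    have G': "(G has_derivative DG) (at x)"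
      unfolding DG_def by (intro frechet_has_derivative Ck_on_differentiable[OF G(3,2)])
    have expand: "DF y (G y) = (\<Sum>b\<in>Basis. (G y \<bullet> b) *\<^sub>R DF y b)" if "y \<in> W" for y
    proof -
      have "DF y (G y) = DF y (\<Sum>b\<in>Basis. (G y \<bullet> b) *\<^sub>R b)" by (simp add: euclidean_representation)
      also have "\<dots> = (\<Sum>b\<in>Basis. (G y \<bullet> b) *\<^sub>R DF y b)"
        by (simp add: linear_sum[OF lin[OF that]] linear_scale[OF lin[OF that]])
      finally show ?thesis .
    qed
    have D2: "((\<lambda>y. DF y b) has_derivative D2 b) (at x)" for b
    proof -
      have "Ck_on 2 F W" using F by blast
      then show ?thesis
        unfolding D2_def DF_def numeral_2_eq_2 using F(2) by (intro frechet_has_derivative) simp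
    qed
    define E where "E v = (\<Sum>b\<in>Basis. (G x \<bullet> b) *\<^sub>R D2 b v + (DG v \<bullet> b) *\<^sub>R DF x b)" for v
    have "((\<lambda>y. \<Sum>b\<in>Basis. (G y \<bullet> b) *\<^sub>R DF y b) has_derivative E) (at x)"
      unfolding E_def
      by (intro has_derivative_sum has_derivative_scaleR D2
          bounded_linear.has_derivative[OF bounded_linear_inner_left G'])
    then have E: "((\<lambda>y. DF y (G y)) has_derivative E) (at x)"
      by (rule has_derivative_transform_within_open[OF _ F(1,2)]) (simp add: expand)
    have Elin: "DF x (DG v) = (\<Sum>b\<in>Basis. (DG v \<bullet> b) *\<^sub>R DF x b)"
      using linear_sum[OF lin[OF F(2)], of "\<lambda>b. (DG v \<bullet> b) *\<^sub>R b" Basis]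
      by (simp add: euclidean_representation linear_scale[OF lin[OF F(2)]])
    have D2lin: "D2 (G x) v = (\<Sum>b\<in>Basis. (G x \<bullet> b) *\<^sub>R D2 b v)"
    proof -
      have "((\<lambda>y. \<Sum>b\<in>Basis. (G x \<bullet> b) *\<^sub>R DF y b) has_derivative
          (\<lambda>v. \<Sum>b\<in>Basis. (G x \<bullet> b) *\<^sub>R D2 b v)) (at x)"
        by (intro has_derivative_sum has_derivative_scaleR_right D2)
      then have "((\<lambda>y. DF y (G x)) has_derivative (\<lambda>v. \<Sum>b\<in>Basis. (G x \<bullet> b) *\<^sub>R D2 b v)) (at x)"
      proof (rule has_derivative_transform_within_open[OF _ F(1,2)])
        fix y assume "y \<in> W"
        then show "(\<Sum>b\<in>Basis. (G x \<bullet> b) *\<^sub>R DF y b) = DF y (G x)"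
          using linear_sum[OF lin, of y "\<lambda>b. (G x \<bullet> b) *\<^sub>R b" Basis]
          by (simp add: euclidean_representation linear_scale[OF lin])
      qed
      from frechet_derivative_eqI[OF this] show ?thesis
        by (simp only: D2_def[of "G x"])
    qed
    have "dir_deriv S (\<lambda>y. dir_deriv S Z y (V y)) x v = frechet_derivative (\<lambda>y. DF y (G y)) (at x) v"
    proof (rule dir_deriv_frechet[OF x v, of "W \<inter> W'"])
      show "(\<lambda>y. DF y (G y)) differentiable at x" using E by (auto simp: differentiable_def)
      show "DF y (G y) = dir_deriv S Z y (V y)" if "y \<in> S" "y \<in> W \<inter> W'" for y
      proof -
        have "dir_deriv S Z y (V y) = DF y (V y)"
          unfolding DF_def using F(5) tV that by blast
        then show ?thesis using G(4) that by simp
      qed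
    qed (use F G in auto)
    also have "\<dots> = E v" by (simp add: frechet_derivative_eqI[OF E])
    also have "\<dots> = D2 (G x) v + DF x (DG v)"
      by (simp add: E_def sum.distrib Elin D2lin)
    finally have "dir_deriv S (\<lambda>y. dir_deriv S Z y (V y)) x v = D2 (G x) v + DF x (DG v)" .
    moreover have "G x = V x" using G x by blast
    moreover have "dir_deriv S V x v = DG v" unfolding DG_def using G x v by blast
    ultimately show ?thesis by simp
  qed
  have "Ck_on 2 F W" using F by blast
  then have sym: "D2 (Y x) (X x) = D2 (X x) (Y x)"
    unfolding D2_def DF_def by (rule second_derivative_symmetric[OF F(1,2)])
  have "dir_deriv S Z x (lie_bracket S X Y x) = DF x (lie_bracket S X Y x)"
    unfolding DF_def using F(5) F(2) x br by blast
  also have "\<dots> = DF x (dir_deriv S Y x (X x)) - DF x (dir_deriv S X x (Y x))"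
    unfolding lie_bracket_def by (rule linear_diff[OF lin[OF F(2)]])
  finally show ?thesis
    using second[OF sm(2) tan(2) tan(1)[OF x]] second[OF sm(1) tan(1) tan(2)[OF x]] sym by simp
qed

text \<open>
  The difference of two Levi-Civita connections is a tensor which is symmetric in its two
  arguments and skew with respect to the metric, hence zero.
\<close>

lemma levi_civita_unique:
  assumes nab: "levi_civita S Tan g nab" and nab': "levi_civita S Tan g nab'"
    and V: "vector_field S Tan V" and Z: "vector_field S Tan Z" and x: "x \<in> S"
    and g_sym: "\<And>u v. u \<in> Tan x \<Longrightarrow> v \<in> Tan x \<Longrightarrow> g x u v = g x v u"
    and g_diff: "\<And>u v w. u \<in> Tan x \<Longrightarrow> v \<in> Tan x \<Longrightarrow> w \<in> Tan x \<Longrightarrow>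
      g x (u - v) w = g x u w - g x v w"
    and g_def: "\<And>u. u \<in> Tan x \<Longrightarrow> g x u u = 0 \<Longrightarrow> u = 0"
  shows "nab V Z x = nab' V Z x"
proof -
  define D where "D V Z y = nab V Z y - nab' V Z y" for V Z y
  have tan: "U x \<in> Tan x" if "vector_field S Tan U" for U
    using that x by (simp add: vector_field_def)
  have nabs: "nab U W x \<in> Tan x" "nab' U W x \<in> Tan x"
    if "vector_field S Tan U" "vector_field S Tan W" for U W
    using levi_civita_unfold(1)[OF nab that] levi_civita_unfold(1)[OF nab' that] by (auto intro: tan)
  have D: "vector_field S Tan (D U W)" if "vector_field S Tan U" "vector_field S Tan W" for U W
    unfolding D_def
    using levi_civita_unfold(1)[OF nab that] levi_civita_unfold(1)[OF nab' that]
    by (rule vector_field_diff)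
  define T where "T U W Q = g x (D U W x) (Q x)" for U W Q
  have sym: "T U W Q = T W U Q" if "vector_field S Tan U" "vector_field S Tan W" for U W Q
  proof -
    have "D U W x - D W U x = 0"
      using levi_civita_unfold(2)[OF nab that x] levi_civita_unfold(2)[OF nab' that x]
      unfolding D_def by (simp add: algebra_simps)
    then show ?thesis by (simp add: T_def)
  qed
  have skew: "T U W Q = - T U Q W"
    if "vector_field S Tan U" "vector_field S Tan W" "vector_field S Tan Q" for U W Q
  proof -
    have "g x (nab U W x) (Q x) + g x (W x) (nab U Q x) =
        g x (nab' U W x) (Q x) + g x (W x) (nab' U Q x)"
      using levi_civita_unfold(3)[OF nab that(1,3) x that(2)]
        levi_civita_unfold(3)[OF nab' that(1,3) x that(2)] by simp
    moreover have "g x (W x) (nab U Q x) = g x (nab U Q x) (W x)"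
      "g x (W x) (nab' U Q x) = g x (nab' U Q x) (W x)"
      using that nabs tan by (auto intro: g_sym)
    moreover have "T U W Q = g x (nab U W x) (Q x) - g x (nab' U W x) (Q x)"
      "T U Q W = g x (nab U Q x) (W x) - g x (nab' U Q x) (W x)"
      unfolding T_def D_def using that nabs tan by (auto intro: g_diff)
    ultimately show ?thesis by simp
  qed
  have "T V Z W = 0" if W: "vector_field S Tan W" for W
  proof -
    have "T V Z W = - T Z W V" using sym[OF V Z] skew[OF Z V W] by simp
    also have "\<dots> = T W V Z" using sym[OF Z W] skew[OF W Z V] by simp
    also have "\<dots> = - T V Z W" using sym[OF W V] skew[OF V W Z] by simp
    finally show ?thesis by simp
  qed
  then have "g x (D V Z x) (D V Z x) = 0"
    using D[OF V Z] by (simp add: T_def)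
  then have "D V Z x = 0" by (rule g_def[OF tan[OF D[OF V Z]]])
  then show ?thesis by (simp add: D_def)
qed

lemma levi_civita_cong:
  assumes nab: "levi_civita S Tan g nab"
    and eq: "\<And>V Z x. vector_field S Tan V \<Longrightarrow> vector_field S Tan Z \<Longrightarrow> x \<in> S \<Longrightarrow> nab' V Z x = nab V Z x"
  shows "levi_civita S Tan g nab'"
proof -
  have "vector_field S Tan (nab' V Z)" if "vector_field S Tan V" "vector_field S Tan Z" for V Z
    by (rule iffD2[OF vector_field_cong[OF eq[OF that]] levi_civita_unfold(1)[OF nab that]])
  moreover have A: "affine_connection S Tan nab" using nab by (simp add: levi_civita_def)
  ultimately show ?thesis
    unfolding levi_civita_def affine_connection_def
  proof (intro conjI allI impI ballI; elim conjE)
    fix V W Z x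
    assume f: "vector_field S Tan V" "vector_field S Tan W" "vector_field S Tan Z" and x: "x \<in> S"
    show "nab' (\<lambda>y. V y + W y) Z x = nab' V Z x + nab' W Z x"
      unfolding eq[OF vector_field_add[OF f(1,2)] f(3) x] eq[OF f(1,3) x] eq[OF f(2,3) x]
      by (rule affine_connection_unfold(1)[OF A f(1,3) x f(2)])
    show "nab' V (\<lambda>y. W y + Z y) x = nab' V W x + nab' V Z x"
      unfolding eq[OF f(1) vector_field_add[OF f(2,3)] x] eq[OF f(1,2) x] eq[OF f(1,3) x]
      by (rule affine_connection_unfold(2)[OF A f(1,3) x f(2)])
    show "dir_deriv S (\<lambda>y. g y (W y) (Z y)) x (V x) =
        g x (nab' V W x) (Z x) + g x (W x) (nab' V Z x)"
      unfolding eq[OF f(1,2) x] eq[OF f(1,3) x]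
      by (rule levi_civita_unfold(3)[OF nab f(1,3) x f(2)])
  next
    fix f :: "'a \<Rightarrow> real" and V Z x
    assume f: "smooth_on S f" "vector_field S Tan V" "vector_field S Tan Z" and x: "x \<in> S"
    show "nab' (\<lambda>y. f y *\<^sub>R V y) Z x = f x *\<^sub>R nab' V Z x"
      unfolding eq[OF vector_field_scaleR[OF f(1,2)] f(3) x] eq[OF f(2,3) x]
      by (rule affine_connection_unfold(3)[OF A f(2,3) x f(1)])
    show "nab' V (\<lambda>y. f y *\<^sub>R Z y) x =
        dir_deriv S f x (V x) *\<^sub>R Z x + f x *\<^sub>R nab' V Z x"
      unfolding eq[OF f(2) vector_field_scaleR[OF f(1,3)] x] eq[OF f(2,3) x]
      by (rule affine_connection_unfold(4)[OF A f(2,3) x f(1)])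
  next
    fix V Z x
    assume f: "vector_field S Tan V" "vector_field S Tan Z" and x: "x \<in> S"
    show "nab' V Z x - nab' Z V x = lie_bracket S V Z x"
      unfolding eq[OF f x] eq[OF f(2,1) x] by (rule levi_civita_unfold(2)[OF nab f x])
  qed
qed

end

text \<open>
  Christoffel functions: in the ambient vector space the connection is the directional
  derivative plus a bilinear correction \<open>\<Gamma>\<close>, whose derivative in the base point is \<open>\<Gamma>'\<close>.
\<close>

locale christoffel = velocity_curves S Tan
  for S :: "'a::euclidean_space set" and Tan :: "'a \<Rightarrow> 'a set" +
  fixes \<Gamma> :: "'a \<Rightarrow> 'a \<Rightarrow> 'a \<Rightarrow> 'a" and \<Gamma>' :: "'a \<Rightarrow> 'a \<Rightarrow> 'a \<Rightarrow> 'a \<Rightarrow> 'a"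
  assumes \<Gamma>_add: "\<Gamma> x (u + v) w = \<Gamma> x u w + \<Gamma> x v w"
    and \<Gamma>_scaleR: "\<Gamma> x (c *\<^sub>R u) w = c *\<^sub>R \<Gamma> x u w"
    and \<Gamma>_sym: "\<Gamma> x u v = \<Gamma> x v u"
    and \<Gamma>_smooth: "smooth_on S V \<Longrightarrow> smooth_on S Z \<Longrightarrow> smooth_on S (\<lambda>x. \<Gamma> x (V x) (Z x))"
    and \<Gamma>_deriv: "smooth_on S V \<Longrightarrow> smooth_on S Z \<Longrightarrow> x \<in> S \<Longrightarrow> u \<in> Tan x \<Longrightarrow>
      dir_deriv S (\<lambda>y. \<Gamma> y (V y) (Z y)) x u =
      \<Gamma>' x u (V x) (Z x) + \<Gamma> x (dir_deriv S V x u) (Z x) + \<Gamma> x (V x) (dir_deriv S Z x u)"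
    and \<Gamma>_tangent: "vector_field S Tan V \<Longrightarrow> vector_field S Tan Z \<Longrightarrow> x \<in> S \<Longrightarrow>
      dir_deriv S Z x (V x) + \<Gamma> x (V x) (Z x) \<in> Tan x"
begin

lemma \<Gamma>_add_right: "\<Gamma> x w (u + v) = \<Gamma> x w u + \<Gamma> x w v"
  using \<Gamma>_add \<Gamma>_sym by metis

lemma \<Gamma>_scaleR_right: "\<Gamma> x w (c *\<^sub>R u) = c *\<^sub>R \<Gamma> x w u"
  using \<Gamma>_scaleR \<Gamma>_sym by metis

lemma \<Gamma>_diff: "\<Gamma> x (u - v) w = \<Gamma> x u w - \<Gamma> x v w"
  using \<Gamma>_add[of x "u - v" v w] by simp

definition nabla :: "('a \<Rightarrow> 'a) \<Rightarrow> ('a \<Rightarrow> 'a) \<Rightarrow> 'a \<Rightarrow> 'a" where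
  "nabla V Z x = dir_deriv S Z x (V x) + \<Gamma> x (V x) (Z x)"

lemma nabla_torsion_free: "nabla V Z x - nabla Z V x = lie_bracket S V Z x"
  by (simp add: nabla_def lie_bracket_def \<Gamma>_sym[of x "V x"])

lemma vector_field_nabla:
  assumes "vector_field S Tan V" "vector_field S Tan Z"
  shows "vector_field S Tan (nabla V Z)"
proof -
  have sm: "smooth_on S V" "smooth_on S Z" using assms by (auto simp: vector_field_def)
  have "smooth_on S (\<lambda>x. dir_deriv S Z x (V x) + \<Gamma> x (V x) (Z x))"
    by (intro smooth_on_add smooth_on_dir_deriv \<Gamma>_smooth assms sm)
  then show ?thesis
    using \<Gamma>_tangent[OF assms] by (simp add: vector_field_def nabla_def[abs_def])
qed

lemma vector_field_lie_bracket:
  assumes "vector_field S Tan V" "vector_field S Tan Z"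
  shows "vector_field S Tan (lie_bracket S V Z)"
proof -
  have "lie_bracket S V Z = (\<lambda>x. nabla V Z x - nabla Z V x)"
    by (simp add: nabla_torsion_free)
  then show ?thesis
    by (simp add: vector_field_diff vector_field_nabla assms)
qed

lemma affine_connection_nabla: "affine_connection S Tan nabla"
  unfolding affine_connection_def
proof (intro conjI allI impI ballI; (elim conjE)?)
  fix V Z assume "vector_field S Tan V" "vector_field S Tan Z"
  then show "vector_field S Tan (nabla V Z)" by (rule vector_field_nabla)
next
  fix V W Z x
  assume "vector_field S Tan V" "vector_field S Tan W" "vector_field S Tan Z" "x \<in> S"
  then show "nabla (\<lambda>y. V y + W y) Z x = nabla V Z x + nabla W Z x"
    by (simp add: nabla_def \<Gamma>_add vector_field_def dir_deriv_add_right)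
next
  fix f :: "'a \<Rightarrow> real" and V Z x
  assume "smooth_on S f" "vector_field S Tan V" "vector_field S Tan Z" "x \<in> S"
  then show "nabla (\<lambda>y. f y *\<^sub>R V y) Z x = f x *\<^sub>R nabla V Z x"
    by (simp add: nabla_def \<Gamma>_scaleR vector_field_def dir_deriv_scaleR_right scaleR_add_right)
next
  fix V W Z x
  assume "vector_field S Tan V" "vector_field S Tan W" "vector_field S Tan Z" "x \<in> S"
  then show "nabla V (\<lambda>y. W y + Z y) x = nabla V W x + nabla V Z x"
    by (simp add: nabla_def \<Gamma>_add_right vector_field_def dir_deriv_add)
next
  fix f :: "'a \<Rightarrow> real" and V Z x
  assume "smooth_on S f" "vector_field S Tan V" "vector_field S Tan Z" "x \<in> S"
  then show "nabla V (\<lambda>y. f y *\<^sub>R Z y) x =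
      dir_deriv S f x (V x) *\<^sub>R Z x + f x *\<^sub>R nabla V Z x"
    by (simp add: nabla_def \<Gamma>_scaleR_right vector_field_def scaleR_add_right
        dir_deriv_bilinear[OF bounded_bilinear_scaleR])
qed

lemma curvature_field_christoffel:
  assumes eq: "\<And>V Z y. vector_field S Tan V \<Longrightarrow> vector_field S Tan Z \<Longrightarrow> y \<in> S \<Longrightarrow> nab V Z y = nabla V Z y"
    and X: "vector_field S Tan X" and Y: "vector_field S Tan Y" and Z: "vector_field S Tan Z"
    and x: "x \<in> S"
  shows "curvature_field S nab X Y Z x =
    \<Gamma>' x (Y x) (X x) (Z x) - \<Gamma>' x (X x) (Y x) (Z x) +
    \<Gamma> x (Y x) (\<Gamma> x (X x) (Z x)) - \<Gamma> x (X x) (\<Gamma> x (Y x) (Z x))"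
proof -
  have sm: "smooth_on S X" "smooth_on S Y" "smooth_on S Z"
    and tan: "X x \<in> Tan x" "Y x \<in> Tan x" "lie_bracket S X Y x \<in> Tan x"
    using X Y Z x vector_field_lie_bracket[OF X Y] by (auto simp: vector_field_def)
  have second: "nab U (nab V Z) x =
      dir_deriv S (\<lambda>y. dir_deriv S Z y (V y)) x (U x) + \<Gamma>' x (U x) (V x) (Z x) +
      \<Gamma> x (dir_deriv S V x (U x)) (Z x) + \<Gamma> x (V x) (dir_deriv S Z x (U x)) +
      \<Gamma> x (U x) (dir_deriv S Z x (V x)) + \<Gamma> x (U x) (\<Gamma> x (V x) (Z x))"
    if U: "vector_field S Tan U" and V: "vector_field S Tan V" for U V
  proof -
    have smU: "smooth_on S V" "U x \<in> Tan x" using U V x by (auto simp: vector_field_def)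
    have f: "vector_field S Tan (nab V Z)"
      by (rule iffD2[OF vector_field_cong[OF eq[OF V Z]] vector_field_nabla[OF V Z]])
    have "nab U (nab V Z) x = dir_deriv S (nab V Z) x (U x) + \<Gamma> x (U x) (nab V Z x)"
      by (simp add: eq[OF U f x] nabla_def)
    also have "dir_deriv S (nab V Z) x (U x) =
        dir_deriv S (\<lambda>y. dir_deriv S Z y (V y) + \<Gamma> y (V y) (Z y)) x (U x)"
      by (rule dir_deriv_cong) (simp add: eq[OF V Z] nabla_def)
    also have "\<dots> = dir_deriv S (\<lambda>y. dir_deriv S Z y (V y)) x (U x) + \<Gamma>' x (U x) (V x) (Z x) +
        \<Gamma> x (dir_deriv S V x (U x)) (Z x) + \<Gamma> x (V x) (dir_deriv S Z x (U x))"
      by (subst dir_deriv_add)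
        (simp_all add: x smU sm V smooth_on_dir_deriv \<Gamma>_smooth \<Gamma>_deriv)
    finally show ?thesis
      by (simp add: eq[OF V Z x] nabla_def \<Gamma>_add_right)
  qed
  have "nab (lie_bracket S X Y) Z x =
      dir_deriv S Z x (lie_bracket S X Y x) + \<Gamma> x (lie_bracket S X Y x) (Z x)"
    by (simp add: eq[OF vector_field_lie_bracket[OF X Y] Z x] nabla_def)
  also have "\<dots> = dir_deriv S (\<lambda>y. dir_deriv S Z y (Y y)) x (X x) -
      dir_deriv S (\<lambda>y. dir_deriv S Z y (X y)) x (Y x) +
      \<Gamma> x (dir_deriv S Y x (X x)) (Z x) - \<Gamma> x (dir_deriv S X x (Y x)) (Z x)"
    by (simp add: dir_deriv_commutator[OF X Y sm(3) x tan(3)]) (simp add: lie_bracket_def \<Gamma>_diff)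
  finally show ?thesis
    unfolding curvature_field_def second[OF X Y] second[OF Y X] by simp
qed

end

section \<open>Block matrices and the lifted curvature formula\<close>

lemma bounded_bilinear_matrix_mult:
  "bounded_bilinear ((**) :: real^'n^'m \<Rightarrow> real^'k^'n \<Rightarrow> real^'k^'m)"
  by (intro bilinear_conv_bounded_bilinear[THEN iffD1])
    (simp add: bilinear_def linear_iff vec_eq_iff matrix_matrix_mult_def sum.distrib
      algebra_simps sum_distrib_left)

lemma bounded_linear_transpose: "bounded_linear (transpose :: real^'n^'m \<Rightarrow> real^'m^'n)"
  by (intro linear_conv_bounded_linear[THEN iffD1]) (simp add: linear_iff vec_eq_iff transpose_def)

lemmas matrix_ring_simps =
  bounded_bilinear.add_left[OF bounded_bilinear_matrix_mult]
  bounded_bilinear.add_right[OF bounded_bilinear_matrix_mult]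
  bounded_bilinear.diff_left[OF bounded_bilinear_matrix_mult]
  bounded_bilinear.diff_right[OF bounded_bilinear_matrix_mult]
  bounded_bilinear.minus_left[OF bounded_bilinear_matrix_mult]
  bounded_bilinear.minus_right[OF bounded_bilinear_matrix_mult]
  bounded_bilinear.scaleR_left[OF bounded_bilinear_matrix_mult]
  bounded_bilinear.scaleR_right[OF bounded_bilinear_matrix_mult]
  matrix_mul_assoc[symmetric]

lemmas transpose_simps =
  linear_add[OF bounded_linear.linear[OF bounded_linear_transpose]]
  linear_diff[OF bounded_linear.linear[OF bounded_linear_transpose]]
  linear_neg[OF bounded_linear.linear[OF bounded_linear_transpose]]
  linear_scale[OF bounded_linear.linear[OF bounded_linear_transpose]]
  linear_0[OF bounded_linear.linear[OF bounded_linear_transpose]]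
  matrix_transpose_mul

lemma trace_transpose_mult: "trace (transpose A ** B) = A \<bullet> (B :: real^'n^'m)"
proof -
  have "trace (transpose A ** B) = (\<Sum>i\<in>UNIV. \<Sum>k\<in>UNIV. A $ k $ i * B $ k $ i)"
    by (simp add: trace_def matrix_matrix_mult_def transpose_def)
  also have "\<dots> = (\<Sum>k\<in>UNIV. \<Sum>i\<in>UNIV. A $ k $ i * B $ k $ i)"
    by (rule sum.swap)
  finally show ?thesis by (simp add: inner_vec_def)
qed

lemma inner_matrix_mult_left: "(A ** B) \<bullet> C = B \<bullet> (transpose A ** (C :: real^'n^'m))"
  by (simp flip: trace_transpose_mult add: matrix_transpose_mul matrix_mul_assoc)

lemma inner_transpose: "transpose A \<bullet> transpose B = A \<bullet> (B :: real^'n^'m)"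
proof -
  have "transpose A \<bullet> transpose B = (\<Sum>i\<in>UNIV. \<Sum>k\<in>UNIV. A $ k $ i * B $ k $ i)"
    by (simp add: inner_vec_def transpose_def)
  also have "\<dots> = (\<Sum>k\<in>UNIV. \<Sum>i\<in>UNIV. A $ k $ i * B $ k $ i)"
    by (rule sum.swap)
  finally show ?thesis by (simp add: inner_vec_def)
qed

lemma inner_matrix_mult_right: "(A ** B) \<bullet> C = A \<bullet> ((C :: real^'n^'m) ** transpose B)"
  using inner_matrix_mult_left[of "transpose B" "transpose A" "transpose C"]
  by (simp add: inner_transpose[of "A ** B", symmetric] inner_transpose[of A, symmetric]
      matrix_transpose_mul)

lemma inner_symmetric_antisymmetric:
  assumes "transpose S = S" "transpose A = - A"
  shows "S \<bullet> (A :: real^'n^'n) = 0"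
  using inner_transpose[of S A] assms by simp

lemma ip_eq_inner: "ip X Y = (X \<bullet> Y) / 2"
  by (simp add: ip_def trace_transpose_mult)

lemma antisym_iff: "X \<in> antisym_mats \<longleftrightarrow> transpose X = - X"
  by (simp add: antisym_mats_def)

lemma antisym_nth:
  assumes "X \<in> antisym_mats"
  shows "X $ i $ j = - (X $ j $ i)"
proof -
  have "X $ i $ j = transpose X $ j $ i" by (simp add: transpose_def)
  also have "\<dots> = - (X $ j $ i)" using assms by (simp add: antisym_iff)
  finally show ?thesis .
qed

lemma antisym_comm_bracket:
  "X \<in> antisym_mats \<Longrightarrow> Y \<in> antisym_mats \<Longrightarrow> comm_bracket X Y \<in> antisym_mats"
  by (simp add: antisym_iff comm_bracket_def transpose_simps matrix_ring_simps)

lemma sum_UNIV_Plus: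
  fixes f :: "'p::finite + 'q::finite \<Rightarrow> 'a::comm_monoid_add"
  shows "(\<Sum>x\<in>UNIV. f x) = (\<Sum>i\<in>UNIV. f (Inl i)) + (\<Sum>j\<in>UNIV. f (Inr j))"
  by (simp flip: UNIV_Plus_UNIV add: sum.Plus)

lemma blk_nth [simp]:
  "blk A B H $ Inl i $ Inl j = A $ i $ j"
  "blk A B H $ Inl i $ Inr l = - (B $ l $ i)"
  "blk A B H $ Inr k $ Inl j = B $ k $ j"
  "blk A B H $ Inr k $ Inr l = H $ k $ l"
  by (simp_all add: blk_def)

lemma blk_eq_iff: "blk A B H = blk A' B' H' \<longleftrightarrow> A = A' \<and> B = B' \<and> H = H'"
  by (auto simp: vec_eq_iff split_sum_all)

lemma blk_add: "blk A B H + blk A' B' H' = blk (A + A') (B + B') (H + H')"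
  by (simp add: vec_eq_iff split_sum_all)

lemma blk_diff: "blk A B H - blk A' B' H' = blk (A - A') (B - B') (H - H')"
  by (simp add: vec_eq_iff split_sum_all)

lemma blk_scaleR: "c *\<^sub>R blk A B H = blk (c *\<^sub>R A) (c *\<^sub>R B) (c *\<^sub>R H)"
  by (simp add: vec_eq_iff split_sum_all)

lemma antisym_blk_iff: "blk A B H \<in> antisym_mats \<longleftrightarrow> A \<in> antisym_mats \<and> H \<in> antisym_mats"
proof -
  have "transpose (blk A B H) = blk (transpose A) (- B) (transpose H)"
    by (simp add: vec_eq_iff split_sum_all transpose_def)
  moreover have "- blk A B H = blk (- A) (- B) (- H)"
    by (simp add: vec_eq_iff split_sum_all)
  ultimately show ?thesis by (simp add: antisym_iff blk_eq_iff)
qed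

lemma antisym_blkE:
  fixes X :: "real^('p::finite + 'q::finite)^('p + 'q)"
  assumes "X \<in> antisym_mats"
  obtains A B H where "X = blk A B H" "A \<in> antisym_mats" "H \<in> antisym_mats"
proof -
  define A where "A = (\<chi> i j. X $ Inl i $ Inl j)"
  define B where "B = (\<chi> i j. X $ Inr i $ Inl j)"
  define H where "H = (\<chi> i j. X $ Inr i $ Inr j)"
  have *: "X $ Inl i $ Inr j = - (X $ Inr j $ Inl i)" for i j
    by (rule antisym_nth[OF assms])
  have "X = blk A B H"
    by (simp add: * vec_eq_iff split_sum_all A_def B_def H_def)
  with assms that show thesis by (simp add: antisym_blk_iff)
qed

lemma inner_blk: "blk A B H \<bullet> blk A' B' H' = A \<bullet> A' + 2 * (B \<bullet> B') + H \<bullet> H'"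
proof -
  have "(\<Sum>i\<in>UNIV. \<Sum>k\<in>UNIV. B $ k $ i * B' $ k $ i) = B \<bullet> B'"
    using inner_transpose[of B B'] by (simp add: inner_vec_def transpose_def)
  then show ?thesis
    by (simp add: inner_vec_def sum_UNIV_Plus sum.distrib)
qed

lemma comm_bracket_blk:
  assumes "A \<in> antisym_mats" "H \<in> antisym_mats" "A' \<in> antisym_mats" "H' \<in> antisym_mats"
  shows "comm_bracket (blk A B H) (blk A' B' H') =
    blk (A ** A' - A' ** A - transpose B ** B' + transpose B' ** B)
      (B ** A' + H ** B' - B' ** A - H' ** B)
      (H ** H' - H' ** H - B ** transpose B' + B' ** transpose B)"
proof -
  have left: "(\<Sum>k\<in>UNIV. M $ i $ k * f k) = - (\<Sum>k\<in>UNIV. f k * M $ k $ i)"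
    if "M \<in> antisym_mats" for M :: "real^'m^'m" and f i
  proof -
    have "M $ i $ k * f k = - (f k * M $ k $ i)" for k
      by (simp add: antisym_nth[OF that, of i k])
    then show ?thesis by (simp add: sum_negf)
  qed
  have right: "(\<Sum>k\<in>UNIV. f k * M $ k $ i) = - (\<Sum>k\<in>UNIV. M $ i $ k * f k)"
    if "M \<in> antisym_mats" for M :: "real^'m^'m" and f i
    using left[OF that] by simp
  show ?thesis
    by (simp add: vec_eq_iff split_sum_all comm_bracket_def matrix_matrix_mult_def sum_UNIV_Plus
        transpose_def sum_negf left[OF assms(1)] left[OF assms(3)]
        right[OF assms(2)] right[OF assms(4)])
qed

lemma oproj_eqI:
  assumes V: "subspace V" and "Z \<in> V" "\<And>W. W \<in> V \<Longrightarrow> ip (X - Z) W = 0"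
  shows "oproj V X = Z"
  unfolding oproj_def
proof (rule the_equality)
  show "Z \<in> V \<and> (\<forall>W\<in>V. ip (X - Z) W = 0)" using assms by blast
  fix Z' assume Z': "Z' \<in> V \<and> (\<forall>W\<in>V. ip (X - Z') W = 0)"
  then have "Z' - Z \<in> V" using V assms(2) by (simp add: subspace_diff)
  then have "(X - Z) \<bullet> (Z' - Z) = 0" "(X - Z') \<bullet> (Z' - Z) = 0"
    using assms(3) Z' by (auto simp: ip_eq_inner)
  then have "(Z' - Z) \<bullet> (Z' - Z) = 0" by (simp add: inner_diff_left)
  then show "Z' = Z" by simp
qed

lemma zero_antisym: "0 \<in> antisym_mats"
  by (simp add: antisym_iff transpose_simps)

lemma blk_0: "blk 0 0 0 = 0"
  by (simp add: vec_eq_iff split_sum_all)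

lemma subspace_blk:
  assumes "subspace P" "subspace Q" "subspace R"
  shows "subspace {blk A B H | A B H. A \<in> P \<and> B \<in> Q \<and> H \<in> R}"
  unfolding subspace_def
proof (intro conjI ballI allI)
  show "0 \<in> {blk A B H | A B H. A \<in> P \<and> B \<in> Q \<and> H \<in> R}"
    using assms blk_0[symmetric] by (auto dest!: subspace_0)
next
  fix X Y assume "X \<in> {blk A B H | A B H. A \<in> P \<and> B \<in> Q \<and> H \<in> R}"
    "Y \<in> {blk A B H | A B H. A \<in> P \<and> B \<in> Q \<and> H \<in> R}"
  then show "X + Y \<in> {blk A B H | A B H. A \<in> P \<and> B \<in> Q \<and> H \<in> R}"
    using assms by (fastforce simp: blk_add intro: subspace_add)
next
  fix X and c :: real assume "X \<in> {blk A B H | A B H. A \<in> P \<and> B \<in> Q \<and> H \<in> R}"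
  then show "c *\<^sub>R X \<in> {blk A B H | A B H. A \<in> P \<and> B \<in> Q \<and> H \<in> R}"
    using assms by (fastforce simp: blk_scaleR intro: subspace_scale)
qed

lemma subspace_antisym: "subspace antisym_mats"
  by (auto simp: subspace_def antisym_iff transpose_simps)

lemma a_sub_eq: "a_sub = {blk A B H | A B H. A \<in> antisym_mats \<and> B \<in> {0} \<and> H \<in> {0}}"
  by (auto simp: a_sub_def)

lemma k_sub_eq: "k_sub = {blk A B H | A B H. A \<in> {0} \<and> B \<in> {0} \<and> H \<in> antisym_mats}"
  by (auto simp: k_sub_def)

lemma m_sub_eq: "m_sub = {blk A B H | A B H. A \<in> antisym_mats \<and> B \<in> UNIV \<and> H \<in> {0}}"
  unfolding m_sub_def a_sub_def b_sub_def
  by (auto simp: blk_add) (metis add.left_neutral add.right_neutral blk_add)+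

lemma n_sub_eq: "n_sub = {blk A B H | A B H. A \<in> {0} \<and> B \<in> UNIV \<and> H \<in> antisym_mats}"
  unfolding n_sub_def k_sub_def b_sub_def
  by (auto simp: blk_add) (metis add.left_neutral add.right_neutral blk_add)+

lemma subspace_subs: "subspace a_sub" "subspace k_sub" "subspace m_sub" "subspace n_sub"
  unfolding a_sub_eq k_sub_eq m_sub_eq n_sub_eq
  by (intro subspace_blk subspace_antisym subspace_single_0 subspace_UNIV)+

lemma oproj_blk:
  assumes "A \<in> antisym_mats" "H \<in> antisym_mats"
  shows "oproj a_sub (blk A B H) = blk A 0 0" "oproj k_sub (blk A B H) = blk 0 0 H"
    "oproj m_sub (blk A B H) = blk A B 0" "oproj n_sub (blk A B H) = blk 0 B H"
  by (intro oproj_eqI subspace_subs;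
      use assms in \<open>auto simp: a_sub_eq k_sub_eq m_sub_eq n_sub_eq blk_diff ip_eq_inner inner_blk blk_eq_iff\<close>)+

lemma P_op_blk:
  assumes "A \<in> antisym_mats" "H \<in> antisym_mats"
  shows "P_op t (blk A B H) = blk (t *\<^sub>R A) B H"
  by (simp add: P_op_def oproj_blk[OF assms] blk_scaleR blk_add)

lemma antisym_scaleR: "A \<in> antisym_mats \<Longrightarrow> c *\<^sub>R A \<in> antisym_mats"
  by (simp add: subspace_antisym subspace_scale)

lemma ip_P_blk:
  assumes "A' \<in> antisym_mats" "H' \<in> antisym_mats"
  shows "ip_P t (blk A B H) (blk A' B' H') = (t / 2) * (A \<bullet> A') + B \<bullet> B' + (H \<bullet> H') / 2"
  by (simp add: ip_P_def P_op_blk[OF assms] ip_eq_inner inner_blk add_divide_distrib)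

lemma antisym_P_op: "X \<in> antisym_mats \<Longrightarrow> P_op t X \<in> antisym_mats"
  by (elim antisym_blkE) (simp add: P_op_blk antisym_blk_iff antisym_scaleR)

lemma P_op_inverse: "X \<in> antisym_mats \<Longrightarrow> t \<noteq> 0 \<Longrightarrow> P_op t (P_op (1 / t) X) = X"
  by (elim antisym_blkE) (simp add: P_op_blk antisym_scaleR)

lemma inner_comm_bracket:
  assumes "A \<in> antisym_mats"
  shows "comm_bracket A W \<bullet> Q = W \<bullet> comm_bracket Q A"
  using assms
  by (simp add: comm_bracket_def inner_diff_left inner_diff_right inner_matrix_mult_left[of A W]
      inner_matrix_mult_right[of W A] antisym_iff matrix_ring_simps)

lemma ad_dagger_eq:
  fixes A X :: "real^('p::finite + 'q::finite)^('p + 'q)"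
  assumes "t \<noteq> 0" and A: "A \<in> antisym_mats" and X: "X \<in> antisym_mats"
  shows "ad_dagger t A X = P_op (1 / t) (comm_bracket (P_op t X) A)"
  unfolding ad_dagger_def
proof (rule the_equality)
  let ?R = "comm_bracket (P_op t X) A"
  have R: "?R \<in> antisym_mats" by (intro antisym_comm_bracket antisym_P_op A X)
  have adj: "ip_P t (comm_bracket A W) X = ip W ?R" for W
    by (simp add: ip_P_def ip_eq_inner inner_comm_bracket[OF A])
  show "P_op (1 / t) ?R \<in> antisym_mats \<and>
      (\<forall>W\<in>antisym_mats. ip_P t (comm_bracket A W) X = ip_P t W (P_op (1 / t) ?R))"
    unfolding adj by (simp add: ip_P_def P_op_inverse[OF R assms(1)] antisym_P_op[OF R])
  fix Z assume Z: "Z \<in> antisym_mats \<and>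
      (\<forall>W\<in>antisym_mats. ip_P t (comm_bracket A W) X = ip_P t W Z)"
  then have "P_op t Z - ?R \<in> antisym_mats"
    using R antisym_P_op subspace_diff[OF subspace_antisym] by blast
  then have "(P_op t Z - ?R) \<bullet> ?R = (P_op t Z - ?R) \<bullet> P_op t Z"
    using Z by (simp add: adj) (simp add: ip_P_def ip_eq_inner)
  then have "(P_op t Z - ?R) \<bullet> (P_op t Z - ?R) = 0"
    by (subst inner_diff_right) linarith
  then have "P_op t Z = ?R" by simp
  then have "P_op (1 / t) ?R = P_op (1 / t) (P_op t Z)" by simp
  also have "\<dots> = Z" using P_op_inverse[of Z "1 / t"] Z assms(1) by simp
  finally show "Z = P_op (1 / t) ?R" by simp
qed

lemma antisym_comm_terms:
  fixes A A' :: "real^'n^'n" and B B' :: "real^'n^'m"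
  assumes "A \<in> antisym_mats" "A' \<in> antisym_mats"
  shows "A ** A' - A' ** A - transpose B ** B' + transpose B' ** B \<in> antisym_mats"
  using assms by (simp add: antisym_iff transpose_simps matrix_ring_simps algebra_simps)

lemma antisym_comm_terms':
  fixes A A' :: "real^'n^'n" and B B' :: "real^'m^'n"
  assumes "A \<in> antisym_mats" "A' \<in> antisym_mats"
  shows "A ** A' - A' ** A - B ** transpose B' + B' ** transpose B \<in> antisym_mats"
  using antisym_comm_terms[OF assms, of "transpose B" "transpose B'"] by simp

lemma ad_dagger_blk:
  assumes "t \<noteq> 0" "A \<in> antisym_mats" "H \<in> antisym_mats" "A' \<in> antisym_mats" "H' \<in> antisym_mats"
  shows "ad_dagger t (blk A B H) (blk A' B' H') =
    blk (A' ** A - A ** A' + (1 / t) *\<^sub>R (transpose B ** B' - transpose B' ** B))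
      (B' ** A + H' ** B - t *\<^sub>R (B ** A') - H ** B')
      (H' ** H - H ** H' - B' ** transpose B + B ** transpose B')"
proof -
  have "P_op (1 / t) (blk (t *\<^sub>R A' ** A - A ** t *\<^sub>R A' - transpose B' ** B + transpose B ** B')
      (B' ** A + H' ** B - B ** t *\<^sub>R A' - H ** B')
      (H' ** H - H ** H' - B' ** transpose B + B ** transpose B')) =
    blk (A' ** A - A ** A' + (1 / t) *\<^sub>R (transpose B ** B' - transpose B' ** B))
      (B' ** A + H' ** B - t *\<^sub>R (B ** A') - H ** B')
      (H' ** H - H ** H' - B' ** transpose B + B ** transpose B')"
    using assms
    by (simp add: P_op_blk antisym_comm_terms antisym_comm_terms' antisym_scaleR blk_eq_iff)
      (simp add: matrix_ring_simps algebra_simps)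
  then show ?thesis
    using assms
    by (simp add: ad_dagger_eq antisym_blk_iff P_op_blk comm_bracket_blk antisym_scaleR)
qed

lemma bracket_P_blk:
  assumes "t \<noteq> 0" "A \<in> antisym_mats" "H \<in> antisym_mats" "A' \<in> antisym_mats" "H' \<in> antisym_mats"
  shows "bracket_P t (blk A B H) (blk A' B' H') =
    blk (A ** A' - A' ** A - transpose B ** B' + transpose B' ** B)
      (t *\<^sub>R (B ** A') + (t - 2) *\<^sub>R (B' ** A) + H ** B' - H' ** B)
      (H ** H' - H' ** H - B ** transpose B' + B' ** transpose B)"
  using assms
  by (simp add: bracket_P_def ad_dagger_blk comm_bracket_blk blk_diff blk_eq_iff)
    (simp add: algebra_simps scaleR_2)

definition stiefel_curvature_A ::
  "real \<Rightarrow> real^'p^'p \<Rightarrow> real^'p^'p \<Rightarrow> real^'p^'p \<Rightarrow> real^'p^'q \<Rightarrow> real^'p^'q \<Rightarrow> real^'p^'q \<Rightarrow> real^'p^'p"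
  where "stiefel_curvature_A \<alpha> A1 A2 A3 B1 B2 B3 =
    ((1 - 2 * \<alpha>) / 4) *\<^sub>R
        (A1 ** transpose B3 ** B2 - A2 ** transpose B3 ** B1
         - transpose B1 ** B3 ** A2 + transpose B2 ** B3 ** A1)
      + ((1 - \<alpha>) / 2) *\<^sub>R
        (A3 ** transpose B1 ** B2 - A3 ** transpose B2 ** B1
         - transpose B1 ** B2 ** A3 + transpose B2 ** B1 ** A3)
      + (1/4) *\<^sub>R
        (comm_bracket (comm_bracket A1 A2) A3
         - A1 ** transpose B2 ** B3 + A2 ** transpose B1 ** B3
         + transpose B3 ** B1 ** A2 - transpose B3 ** B2 ** A1)"

definition stiefel_curvature_B ::
  "real \<Rightarrow> real^'p^'p \<Rightarrow> real^'p^'p \<Rightarrow> real^'p^'p \<Rightarrow> real^'p^'q \<Rightarrow> real^'p^'q \<Rightarrow> real^'p^'q \<Rightarrow> real^'p^'q"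
  where "stiefel_curvature_B \<alpha> A1 A2 A3 B1 B2 B3 =
    ((2 * \<alpha>\<^sup>2 - \<alpha>) / 2) *\<^sub>R (B1 ** A3 ** A2 - B2 ** A3 ** A1)
      + (\<alpha>\<^sup>2 - \<alpha>) *\<^sub>R (B3 ** A1 ** A2 - B3 ** A2 ** A1)
      + (1 - \<alpha>) *\<^sub>R (B3 ** transpose B1 ** B2 - B3 ** transpose B2 ** B1)
      + ((\<alpha> - 2) / 2) *\<^sub>R (B1 ** transpose B2 ** B3 - B2 ** transpose B1 ** B3)
      + (\<alpha> / 2) *\<^sub>R
        (B1 ** A2 ** A3 - B1 ** transpose B3 ** B2
         - B2 ** A1 ** A3 + B2 ** transpose B3 ** B1)"

lemma lifted_curvature_eq:
  fixes A1 A2 A3 :: "real^'p::finite^'p" and B1 B2 B3 :: "real^'p^'q::finite"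
  assumes t: "t \<noteq> 0" and A: "A1 \<in> antisym_mats" "A2 \<in> antisym_mats" "A3 \<in> antisym_mats"
    and w: "\<omega>1 = blk A1 B1 0" "\<omega>2 = blk A2 B2 0" "\<omega>3 = blk A3 B3 0"
  shows "oproj m_sub
      ((1/2) *\<^sub>R bracket_P t (comm_bracket \<omega>1 \<omega>2) \<omega>3
        - (1/4) *\<^sub>R bracket_P t \<omega>1 (bracket_P t \<omega>2 \<omega>3)
        + (1/4) *\<^sub>R bracket_P t \<omega>2 (bracket_P t \<omega>1 \<omega>3)
        + (1/2) *\<^sub>R ad_dagger t \<omega>3 (oproj k_sub (comm_bracket \<omega>1 \<omega>2))
        - (1/4) *\<^sub>R ad_dagger t \<omega>1 (oproj k_sub (comm_bracket \<omega>2 \<omega>3))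
        + (1/4) *\<^sub>R ad_dagger t \<omega>2 (oproj k_sub (comm_bracket \<omega>1 \<omega>3))) =
    blk (stiefel_curvature_A (t / 2) A1 A2 A3 B1 B2 B3) (stiefel_curvature_B (t / 2) A1 A2 A3 B1 B2 B3) 0"
proof -
  define a where "a A B A' B' = A ** A' - A' ** A - transpose B ** B' + transpose B' ** B"
    for A A' :: "real^'p^'p" and B B' :: "real^'p^'q"
  define h where "h B B' = B' ** transpose B - B ** transpose B'" for B B' :: "real^'p^'q"
  define b where "b s A B A' B' = s *\<^sub>R (B ** A') + (s - 2) *\<^sub>R (B' ** A)"
    for s and A A' :: "real^'p^'p" and B B' :: "real^'p^'q"
  have a: "a A B A' B' \<in> antisym_mats" if "A \<in> antisym_mats" "A' \<in> antisym_mats" for A A' B B'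
    unfolding a_def using that by (rule antisym_comm_terms)
  have h: "h B B' \<in> antisym_mats" for B B'
    by (simp add: h_def antisym_iff transpose_simps)
  have comm: "comm_bracket (blk A B 0) (blk A' B' 0) = blk (a A B A' B') (b 1 A B A' B') (h B B')"
    and brP: "bracket_P t (blk A B 0) (blk A' B' 0) = blk (a A B A' B') (b t A B A' B') (h B B')"
    if "A \<in> antisym_mats" "A' \<in> antisym_mats" for A A' B B'
    using that by (simp_all add: comm_bracket_blk bracket_P_blk t zero_antisym blk_eq_iff a_def b_def h_def)
  have brPr: "bracket_P t (blk A B 0) (blk A' B' H') =
      blk (a A B A' B') (b t A B A' B' - H' ** B) (h B B')"
    and brPl: "bracket_P t (blk A' B' H') (blk A B 0) =
      blk (a A' B' A B) (b t A' B' A B + H' ** B) (h B' B)"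
    and adk: "ad_dagger t (blk A B 0) (oproj k_sub (blk A' B' H')) = blk 0 (H' ** B) 0"
    if "A \<in> antisym_mats" "A' \<in> antisym_mats" "H' \<in> antisym_mats" for A A' B B' H'
    using that by (simp_all add: bracket_P_blk ad_dagger_blk oproj_blk t zero_antisym blk_eq_iff
        a_def b_def h_def transpose_simps)
  define M where "M = (1/2) *\<^sub>R a (a A1 B1 A2 B2) (b 1 A1 B1 A2 B2) A3 B3
      - (1/4) *\<^sub>R a A1 B1 (a A2 B2 A3 B3) (b t A2 B2 A3 B3)
      + (1/4) *\<^sub>R a A2 B2 (a A1 B1 A3 B3) (b t A1 B1 A3 B3)"
  define N where "N = (1/2) *\<^sub>R (b t (a A1 B1 A2 B2) (b 1 A1 B1 A2 B2) A3 B3 + h B1 B2 ** B3)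
      - (1/4) *\<^sub>R (b t A1 B1 (a A2 B2 A3 B3) (b t A2 B2 A3 B3) - h B2 B3 ** B1)
      + (1/4) *\<^sub>R (b t A2 B2 (a A1 B1 A3 B3) (b t A1 B1 A3 B3) - h B1 B3 ** B2)
      + (1/2) *\<^sub>R (h B1 B2 ** B3) - (1/4) *\<^sub>R (h B2 B3 ** B1) + (1/4) *\<^sub>R (h B1 B3 ** B2)"
  define K where "K = (1/2) *\<^sub>R h (b 1 A1 B1 A2 B2) B3 - (1/4) *\<^sub>R h B1 (b t A2 B2 A3 B3)
      + (1/4) *\<^sub>R h B2 (b t A1 B1 A3 B3)"
  note sub = subspace_add[OF subspace_antisym] subspace_diff[OF subspace_antisym] antisym_scaleR a h A
  have MK: "M \<in> antisym_mats" "K \<in> antisym_mats"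
    unfolding M_def K_def by (intro sub)+
  have "(1/2) *\<^sub>R bracket_P t (comm_bracket \<omega>1 \<omega>2) \<omega>3
        - (1/4) *\<^sub>R bracket_P t \<omega>1 (bracket_P t \<omega>2 \<omega>3)
        + (1/4) *\<^sub>R bracket_P t \<omega>2 (bracket_P t \<omega>1 \<omega>3)
        + (1/2) *\<^sub>R ad_dagger t \<omega>3 (oproj k_sub (comm_bracket \<omega>1 \<omega>2))
        - (1/4) *\<^sub>R ad_dagger t \<omega>1 (oproj k_sub (comm_bracket \<omega>2 \<omega>3))
        + (1/4) *\<^sub>R ad_dagger t \<omega>2 (oproj k_sub (comm_bracket \<omega>1 \<omega>3)) = blk M N K"
    by (simp add: w comm brP brPr brPl adk a h A blk_add blk_diff blk_scaleR M_def N_def K_def)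
  then have "oproj m_sub
      ((1/2) *\<^sub>R bracket_P t (comm_bracket \<omega>1 \<omega>2) \<omega>3
        - (1/4) *\<^sub>R bracket_P t \<omega>1 (bracket_P t \<omega>2 \<omega>3)
        + (1/4) *\<^sub>R bracket_P t \<omega>2 (bracket_P t \<omega>1 \<omega>3)
        + (1/2) *\<^sub>R ad_dagger t \<omega>3 (oproj k_sub (comm_bracket \<omega>1 \<omega>2))
        - (1/4) *\<^sub>R ad_dagger t \<omega>1 (oproj k_sub (comm_bracket \<omega>2 \<omega>3))
        + (1/4) *\<^sub>R ad_dagger t \<omega>2 (oproj k_sub (comm_bracket \<omega>1 \<omega>3))) = blk M N 0"
    by (simp add: oproj_blk MK)
  moreover have tr: "transpose A1 = - A1" "transpose A2 = - A2" "transpose A3 = - A3"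
    using A by (simp_all add: antisym_iff)
  have "M = stiefel_curvature_A (t / 2) A1 A2 A3 B1 B2 B3"
    unfolding M_def stiefel_curvature_A_def a_def b_def comm_bracket_def
    by (simp only: matrix_ring_simps transpose_simps tr transpose_transpose)
      (simp add: vec_eq_iff, simp add: field_simps)
  moreover have "N = stiefel_curvature_B (t / 2) A1 A2 A3 B1 B2 B3"
    unfolding N_def stiefel_curvature_B_def a_def b_def h_def
    by (simp only: matrix_ring_simps transpose_simps tr transpose_transpose)
      (simp add: vec_eq_iff, simp add: field_simps power2_eq_square)
  ultimately show ?thesis by simp
qed

section \<open>The submersion onto the Stiefel manifold\<close>

lemma orthogonal_columns:
  fixes U :: "real^('p::finite + 'q::finite)^('p + 'q)"
  assumes "orthogonal_matrix U"
  shows "transpose (left_cols U) ** left_cols U = mat 1"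
    and "transpose (left_cols U) ** right_cols U = 0"
    and "transpose (right_cols U) ** left_cols U = 0"
    and "transpose (right_cols U) ** right_cols U = mat 1"
    and "left_cols U ** transpose (left_cols U) + right_cols U ** transpose (right_cols U) = mat 1"
proof -
  have U: "transpose U ** U = mat 1" "U ** transpose U = mat 1"
    using assms by (auto simp: orthogonal_matrix_def)
  have e: "(\<Sum>k\<in>UNIV. U $ k $ i * U $ k $ j) = (if i = j then 1 else 0)" for i j
    using arg_cong[OF U(1), of "\<lambda>M. M $ i $ j"]
    by (simp add: matrix_matrix_mult_def transpose_def mat_def)
  have e': "(\<Sum>k\<in>UNIV. U $ i $ k * U $ j $ k) = (if i = j then 1 else 0)" for i j
    using arg_cong[OF U(2), of "\<lambda>M. M $ i $ j"]
    by (simp add: matrix_matrix_mult_def transpose_def mat_def)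
  show "transpose (left_cols U) ** left_cols U = mat 1"
    "transpose (left_cols U) ** right_cols U = 0"
    "transpose (right_cols U) ** left_cols U = 0"
    "transpose (right_cols U) ** right_cols U = mat 1"
    by (simp_all add: vec_eq_iff matrix_matrix_mult_def transpose_def mat_def left_cols_def
        right_cols_def e)
  show "left_cols U ** transpose (left_cols U) + right_cols U ** transpose (right_cols U) = mat 1"
    using e' by (simp add: vec_eq_iff matrix_matrix_mult_def transpose_def mat_def left_cols_def
        right_cols_def sum_UNIV_Plus)
qed

lemma left_cols_mult_blk:
  "left_cols (U ** blk A B H) = left_cols U ** A + right_cols U ** B"
  by (simp add: vec_eq_iff left_cols_def right_cols_def matrix_matrix_mult_def sum_UNIV_Plus)

lemma right_cols_mult_blk:
  "right_cols (U ** blk A B H) = right_cols U ** H - left_cols U ** transpose B"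
  by (simp add: vec_eq_iff left_cols_def right_cols_def matrix_matrix_mult_def sum_UNIV_Plus
      transpose_def sum_negf)

lemma join_cols_eq_iff: "v = join_cols Y Z \<longleftrightarrow> left_cols v = Y \<and> right_cols v = Z"
  by (auto simp: vec_eq_iff split_sum_all join_cols_def left_cols_def right_cols_def)

lemma columns_expansion:
  fixes U :: "real^('p::finite + 'q::finite)^('p + 'q)" and x :: "real^'m^('p + 'q)"
  assumes "orthogonal_matrix U"
  shows "x = left_cols U ** (transpose (left_cols U) ** x) + right_cols U ** (transpose (right_cols U) ** x)"
proof -
  have "(left_cols U ** transpose (left_cols U) + right_cols U ** transpose (right_cols U)) ** x = x"
    by (simp add: orthogonal_columns(5)[OF assms])
  then show ?thesis by (simp add: matrix_ring_simps)
qed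

lemma SO_orthogonal: "U \<in> SO_group \<Longrightarrow> orthogonal_matrix U"
  by (simp add: SO_group_def rotation_matrix_def)

lemma left_cols_Stiefel: "U \<in> SO_group \<Longrightarrow> left_cols U \<in> Stiefel"
  by (simp add: Stiefel_def orthogonal_columns SO_orthogonal)

lemma mult_cancel_left:
  assumes "P ** Q = mat 1" shows "P ** (Q ** X) = (X :: real^'m^'n)"
  by (simp add: assms matrix_mul_assoc)

lemma mult_zero_left:
  assumes "P ** Q = (0 :: real^'k^'l)" shows "P ** (Q ** X) = 0"
  by (simp add: assms matrix_mul_assoc)

lemmas SO_columns =
  orthogonal_columns(1-4)[OF SO_orthogonal]
  mult_cancel_left[OF orthogonal_columns(1)[OF SO_orthogonal]]
  mult_zero_left[OF orthogonal_columns(2)[OF SO_orthogonal]]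
  mult_zero_left[OF orthogonal_columns(3)[OF SO_orthogonal]]
  mult_cancel_left[OF orthogonal_columns(4)[OF SO_orthogonal]]

lemma Stiefel_tangent_decomp:
  fixes U :: "real^('p::finite + 'q::finite)^('p + 'q)"
  assumes U: "U \<in> SO_group"
  shows "v \<in> Stiefel_tangent (left_cols U) \<longleftrightarrow>
    (\<exists>A\<in>antisym_mats. \<exists>B. v = left_cols U ** A + right_cols U ** B)"
proof
  assume "v \<in> Stiefel_tangent (left_cols U)"
  then show "\<exists>A\<in>antisym_mats. \<exists>B. v = left_cols U ** A + right_cols U ** B"
    using columns_expansion[OF SO_orthogonal[OF U], of v]
    by (auto simp: Stiefel_tangent_def)
next
  assume "\<exists>A\<in>antisym_mats. \<exists>B. v = left_cols U ** A + right_cols U ** B"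
  then show "v \<in> Stiefel_tangent (left_cols U)"
    by (auto simp: Stiefel_tangent_def matrix_ring_simps SO_columns[OF U])
qed

lemma horizontal_lift_iff:
  fixes U :: "real^('p::finite + 'q::finite)^('p + 'q)"
  assumes U: "U \<in> SO_group"
  shows "is_horizontal_lift U (left_cols U ** A + right_cols U ** B) v \<longleftrightarrow>
    A \<in> antisym_mats \<and> v = U ** blk A B 0"
proof -
  have inj: "A' = A \<and> B' = B"
    if "left_cols U ** A' + right_cols U ** B' = left_cols U ** A + right_cols U ** B" for A' B'
    using arg_cong[OF that, of "\<lambda>x. transpose (left_cols U) ** x"]
      arg_cong[OF that, of "\<lambda>x. transpose (right_cols U) ** x"]
    by (simp add: matrix_ring_simps SO_columns[OF U])
  then show ?thesis
    by (auto simp: is_horizontal_lift_def horizontal_space_def left_cols_mult_blk dest!: inj)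
qed

lemma horizontal_lift_eq_join_cols:
  fixes U :: "real^('p::finite + 'q::finite)^('p + 'q)"
  assumes U: "U \<in> SO_group" and tan: "\<eta> \<in> Stiefel_tangent (left_cols U)"
  shows "is_horizontal_lift U \<eta> v \<longleftrightarrow>
    v = join_cols \<eta> (- (left_cols U ** transpose \<eta> ** right_cols U))"
proof -
  obtain A B where A: "A \<in> antisym_mats" and \<eta>: "\<eta> = left_cols U ** A + right_cols U ** B"
    using Stiefel_tangent_decomp[OF U] tan by blast
  have "U ** blk A B 0 = join_cols \<eta> (- (left_cols U ** transpose \<eta> ** right_cols U))"
    by (simp add: join_cols_eq_iff left_cols_mult_blk right_cols_mult_blk \<eta> matrix_ring_simps
        transpose_simps SO_columns[OF U])
  then show ?thesis
    using A unfolding \<eta> horizontal_lift_iff[OF U] by simp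
qed

lemma Stiefel_columns_orthonormal:
  "Y \<in> Stiefel \<Longrightarrow> column i Y \<bullet> column j Y = (if i = j then 1 else 0)"
  by (simp add: Stiefel_def matrix_mult_transpose_dot_column vec_eq_iff mat_def)

lemma Stiefel_extension:
  fixes Y :: "real^'p^('p::finite + 'q::finite)"
  assumes "Y \<in> Stiefel"
  obtains U :: "real^('p + 'q)^('p + 'q)" where "U \<in> SO_group" "left_cols U = Y"
proof -
  define c where "c i = column i Y" for i
  have c: "c i \<bullet> c j = (if i = j then 1 else 0)" for i j
    unfolding c_def by (rule Stiefel_columns_orthonormal[OF assms])
  have inj: "inj c"
  proof (rule injI)
    fix i j assume "c i = c j"
    then show "i = j" using c[of i i] c[of i j] by (auto split: if_splits)
  qed
  have "pairwise orthogonal (range c)"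
    by (auto simp: pairwise_def orthogonal_def c split: if_splits)
  moreover have "0 \<notin> range c" using c by (metis imageE inner_zero_left zero_neq_one)
  ultimately have "independent (range c)"
    by (rule pairwise_orthogonal_independent)
  then have dimc: "dim (range c) = CARD('p)"
    using inj by (simp add: dim_eq_card card_image)
  define T where "T = {y. \<forall>x\<in>span (range c). orthogonal x y}"
  have "dim T + dim (span (range c)) = dim (UNIV :: (real^('p + 'q)) set)"
    using dim_subspace_orthogonal_to_vectors[OF subspace_span[of "range c"] subspace_UNIV]
    unfolding T_def by simp
  then have dimT: "dim T = CARD('q)" by (simp add: dimc)
  have "subspace T"
    unfolding T_def by (simp add: subspace_orthogonal_to_vectors)
  then obtain B where B: "B \<subseteq> T" "pairwise orthogonal B" "\<forall>x\<in>B. norm x = 1"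
    "independent B" "card B = dim T"
    using orthonormal_basis_subspace[of T] by metis
  have "finite B" using B(4) independent_imp_finite by blast
  then obtain h where h: "bij_betw h (UNIV :: 'q set) B"
    using finite_same_card_bij[of "UNIV :: 'q set" B] B(5) dimT by auto
  have hB: "h k \<in> B" for k using h by (auto simp: bij_betw_def)
  have hh: "h k \<bullet> h l = (if k = l then 1 else 0)" for k l
  proof (cases "k = l")
    case True
    then show ?thesis using B(3) hB by (simp add: norm_eq_1)
  next
    case False
    then have "h k \<noteq> h l" using h by (auto simp: bij_betw_def inj_on_def)
    then show ?thesis using B(2) hB False by (auto simp: pairwise_def orthogonal_def)
  qed
  have ch: "c i \<bullet> h k = 0" for i k
    using hB[of k] B(1) span_base[of "c i" "range c"] by (auto simp: T_def orthogonal_def)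
  define U where "U = join_cols Y (\<chi> i k. h k $ i)"
  have colU: "column (Inl i) U = c i" "column (Inr k) U = h k" for i k
    by (simp_all add: U_def column_def join_cols_def c_def vec_eq_iff)
  have U: "orthogonal_matrix U"
    unfolding orthogonal_matrix matrix_mult_transpose_dot_column
    by (simp add: vec_eq_iff split_sum_all mat_def colU c hh ch inner_commute[of "h _" "c _"])
  have left: "left_cols U = Y"
    by (simp add: U_def left_cols_def join_cols_def vec_eq_iff)
  show thesis
  proof (cases "det U = 1")
    case True
    then show ?thesis using that U left by (simp add: SO_group_def rotation_matrix_def)
  next
    case False
    define d :: "'p + 'q \<Rightarrow> real" where "d i = (if i = Inr undefined then - 1 else 1)" for i
    define D where "D = (\<chi> i j. if i = j then d i else 0)"
    have dd: "d i * d i = 1" for i by (simp add: d_def)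
    have mult_D: "(M ** D) $ i $ j = M $ i $ j * d j" for M :: "real^('p + 'q)^('p + 'q)" and i j
      by (simp add: matrix_matrix_mult_def D_def if_distrib cong: if_cong)
    have "transpose D = D" by (simp add: D_def transpose_def vec_eq_iff)
    moreover have "D ** D = mat 1"
      by (simp add: vec_eq_iff mult_D) (simp add: D_def mat_def dd)
    ultimately have "orthogonal_matrix D" by (simp add: orthogonal_matrix_def)
    then have "orthogonal_matrix (U ** D)" by (rule orthogonal_matrix_mul[OF U])
    moreover have "det D = - 1"
    proof -
      have "det D = prod d UNIV" by (subst det_diagonal) (simp_all add: D_def)
      also have "\<dots> = - 1" by (simp add: d_def[abs_def] prod.delta)
      finally show ?thesis .
    qed
    then have "det (U ** D) = 1"
      using det_orthogonal_matrix[OF U] False by (simp add: det_mul)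
    moreover have "left_cols (U ** D) = Y"
      unfolding left[symmetric] by (simp add: left_cols_def vec_eq_iff mult_D d_def)
    ultimately show ?thesis using that by (simp add: SO_group_def rotation_matrix_def)
  qed
qed

definition stiefel_ip :: "real \<Rightarrow> real^'p^'n \<Rightarrow> real^'p^'n \<Rightarrow> real^'p^'n \<Rightarrow> real" where
  "stiefel_ip t Y \<eta> \<zeta> = \<eta> \<bullet> \<zeta> + (t / 2 - 1) * ((transpose Y ** \<eta>) \<bullet> (transpose Y ** \<zeta>))"

lemma stiefel_ip_decomp:
  fixes U :: "real^('p::finite + 'q::finite)^('p + 'q)"
  assumes U: "U \<in> SO_group"
  shows "stiefel_ip t (left_cols U) (left_cols U ** A + right_cols U ** B)
      (left_cols U ** A' + right_cols U ** B') = (t / 2) * (A \<bullet> A') + B \<bullet> B'"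
proof -
  have "(left_cols U ** A + right_cols U ** B) \<bullet> (left_cols U ** A' + right_cols U ** B') =
      A \<bullet> A' + B \<bullet> B'"
    by (simp add: inner_add_left inner_matrix_mult_left matrix_ring_simps SO_columns[OF U])
  then show ?thesis
    by (simp add: stiefel_ip_def matrix_ring_simps SO_columns[OF U] algebra_simps)
qed

lemma matrix_inv_eqI:
  assumes "A ** B = mat 1" "B ** A = mat 1"
  shows "matrix_inv A = B"
  unfolding matrix_inv_def
proof (rule some_equality)
  show "A ** B = mat 1 \<and> B ** A = mat 1" using assms by simp
  fix B' assume "A ** B' = mat 1 \<and> B' ** A = mat 1"
  then have "B' = (B ** A) ** B'" by (simp add: assms)
  also have "\<dots> = B" using \<open>A ** B' = mat 1 \<and> B' ** A = mat 1\<close> by (simp flip: matrix_mul_assoc)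
  finally show "B' = B" .
qed

lemma SO_metric_blk:
  assumes U: "U \<in> SO_group" and "A' \<in> antisym_mats"
  shows "SO_metric t U (U ** blk A B 0) (U ** blk A' B' 0) = (t / 2) * (A \<bullet> A') + B \<bullet> B'"
proof -
  have U: "transpose U ** U = mat 1" "U ** transpose U = mat 1"
    using SO_orthogonal[OF U] by (simp_all add: orthogonal_matrix_def)
  then have "matrix_inv U = transpose U" by (intro matrix_inv_eqI)
  with U(1) show ?thesis
    by (simp add: SO_metric_def mult_cancel_left ip_P_blk assms(2) zero_antisym)
qed

lemma quotient_metric_eq:
  fixes Y :: "real^'p^('p::finite + 'q::finite)"
  assumes Y: "Y \<in> Stiefel" and tan: "\<eta> \<in> Stiefel_tangent Y" "\<zeta> \<in> Stiefel_tangent Y"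
  shows "quotient_metric t Y \<eta> \<zeta> = stiefel_ip t Y \<eta> \<zeta>"
proof -
  have lift: "\<exists>v w. is_horizontal_lift U \<eta> v \<and> is_horizontal_lift U \<zeta> w"
    and val: "is_horizontal_lift U \<eta> v \<Longrightarrow> is_horizontal_lift U \<zeta> w \<Longrightarrow>
      SO_metric t U v w = stiefel_ip t Y \<eta> \<zeta>"
    if U: "U \<in> SO_group" "left_cols U = Y" for U v w
  proof -
    obtain A B where A: "A \<in> antisym_mats" and \<eta>: "\<eta> = left_cols U ** A + right_cols U ** B"
      using Stiefel_tangent_decomp[OF U(1), of \<eta>] tan U(2) by blast
    obtain A' B' where A': "A' \<in> antisym_mats" and \<zeta>: "\<zeta> = left_cols U ** A' + right_cols U ** B'"
      using Stiefel_tangent_decomp[OF U(1), of \<zeta>] tan U(2) by blast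
    show "\<exists>v w. is_horizontal_lift U \<eta> v \<and> is_horizontal_lift U \<zeta> w"
      using A A' by (simp add: \<eta> \<zeta> horizontal_lift_iff[OF U(1)])
    show "SO_metric t U v w = stiefel_ip t Y \<eta> \<zeta>"
      if "is_horizontal_lift U \<eta> v" "is_horizontal_lift U \<zeta> w"
      using that A' U(2)[symmetric]
      by (simp add: \<eta> \<zeta> horizontal_lift_iff[OF U(1)] SO_metric_blk[OF U(1)] stiefel_ip_decomp[OF U(1)])
  qed
  obtain U :: "real^('p + 'q)^('p + 'q)" where U: "U \<in> SO_group" "left_cols U = Y"
    using Stiefel_extension[OF Y] .
  show ?thesis
    unfolding quotient_metric_def
  proof (rule the_equality)
    show "\<forall>U v w. U \<in> SO_group \<and> left_cols U = Y \<and> is_horizontal_lift U \<eta> v \<and>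
        is_horizontal_lift U \<zeta> w \<longrightarrow> stiefel_ip t Y \<eta> \<zeta> = SO_metric t U v w"
      using val by metis
    fix r assume "\<forall>U v w. U \<in> SO_group \<and> left_cols U = Y \<and> is_horizontal_lift U \<eta> v \<and>
        is_horizontal_lift U \<zeta> w \<longrightarrow> r = SO_metric t U v w"
    then show "r = stiefel_ip t Y \<eta> \<zeta>" using lift[OF U] val[OF U] U by metis
  qed
qed

lemma stiefel_ip_trace:
  "stiefel_ip t Y \<eta> \<eta> =
    trace (\<eta> ** transpose \<eta> + (t / 2 - 1) *\<^sub>R (Y ** transpose Y ** \<eta> ** transpose \<eta>))"
proof -
  have trace_scaleR: "trace (c *\<^sub>R M) = c * trace M" for c :: real and M :: "real^'n^'n"
    by (simp add: trace_def sum_distrib_left)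
  have "trace (Y ** transpose Y ** \<eta> ** transpose \<eta>) = (transpose Y ** \<eta>) \<bullet> (transpose Y ** \<eta>)"
    by (simp flip: trace_transpose_mult add: matrix_transpose_mul)
      (metis matrix_mul_assoc trace_mul_sym)
  then show ?thesis
    by (simp add: stiefel_ip_def trace_add trace_scaleR trace_mul_sym[of \<eta>] trace_transpose_mult)
qed

lemma has_vector_derivative_quadratic_bound:
  fixes \<gamma> :: "real \<Rightarrow> 'a::real_normed_vector"
  assumes "\<And>s. norm (\<gamma> s - \<gamma> 0 - s *\<^sub>R v) \<le> c * s\<^sup>2"
  shows "(\<gamma> has_vector_derivative v) (at 0)"
  unfolding has_vector_derivative_def has_derivative_at
proof
  show "bounded_linear (\<lambda>x. x *\<^sub>R v)" by (rule bounded_linear_scaleR_left)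
  have lim: "((\<lambda>h. c * \<bar>h\<bar>) \<longlongrightarrow> 0) (at (0::real))"
    by (auto intro!: tendsto_eq_intros)
  show "(\<lambda>h. norm (\<gamma> (0 + h) - \<gamma> 0 - h *\<^sub>R v) / norm h) \<midarrow>0\<rightarrow> 0"
  proof (rule Lim_transform_bound[OF _ lim])
    have "norm (\<gamma> h - \<gamma> 0 - h *\<^sub>R v) / \<bar>h\<bar> \<le> \<bar>c * \<bar>h\<bar>\<bar>" for h
    proof -
      have "norm (\<gamma> h - \<gamma> 0 - h *\<^sub>R v) / \<bar>h\<bar> \<le> c * h\<^sup>2 / \<bar>h\<bar>"
        using assms by (intro divide_right_mono) auto
      also have "\<dots> = c * \<bar>h\<bar>" by (cases "h = 0") (auto simp: power2_eq_square abs_if)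
      finally show ?thesis by linarith
    qed
    then show "\<forall>\<^sub>F h in at 0. norm (norm (\<gamma> (0 + h) - \<gamma> 0 - h *\<^sub>R v) / norm h) \<le> norm (c * \<bar>h\<bar>)"
      by simp
  qed
qed

text \<open>
  The Cayley transform \<open>s \<mapsto> (1 - s K / 2)\<^sup>-\<^sup>1 (1 + s K / 2)\<close> of an antisymmetric matrix \<open>K\<close>
  replaces the matrix exponential.
\<close>

lemma cayley_curve:
  fixes K :: "real^'n^'n"
  assumes K: "K \<in> antisym_mats"
  obtains C :: "real \<Rightarrow> real^'n^'n" where "\<forall>s. transpose (C s) ** C s = mat 1" "C 0 = mat 1"
    "\<forall>s. C s - mat 1 = (s / 2) *\<^sub>R (K ** (C s + mat 1))"
proof -
  define M where "M s = mat 1 - (s / 2) *\<^sub>R K" for s :: real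
  define P where "P s = mat 1 + (s / 2) *\<^sub>R K" for s :: real
  have tK: "transpose K = - K" using K by (simp add: antisym_iff)
  have tM: "transpose (M s) = P s" and tP: "transpose (P s) = M s" for s
    by (simp_all add: M_def P_def transpose_simps tK)
  have MP: "M s ** P s = P s ** M s" for s
    by (simp add: M_def P_def matrix_ring_simps) (simp add: vec_eq_iff algebra_simps)
  have "\<exists>B. B ** M s = mat 1" for s
  proof (subst matrix_left_invertible_ker, intro allI impI)
    fix x assume "M s *v x = 0"
    then have "x = (s / 2) *\<^sub>R (K *v x)"
      by (simp add: M_def matrix_vector_mult_diff_rdistrib scaleR_matrix_vector_assoc)
    moreover have "x \<bullet> (K *v x) = 0"
    proof -
      have "x \<bullet> (K *v x) = (transpose K *v x) \<bullet> x"
        by (metis dot_lmul_matrix transpose_matrix_vector)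
      also have "\<dots> = - (x \<bullet> (K *v x))"
        by (simp add: tK inner_commute matrix_vector_mult_def inner_vec_def sum_negf)
      finally show ?thesis by simp
    qed
    ultimately have "x \<bullet> x = 0" by (metis inner_scaleR_right mult_zero_right)
    then show "x = 0" by simp
  qed
  then obtain N where NM: "N s ** M s = mat 1" for s by metis
  then have MN: "M s ** N s = mat 1" for s by (metis matrix_left_right_inverse)
  have tN: "P s ** transpose (N s) = mat 1" "transpose (N s) ** P s = mat 1" for s
    using arg_cong[OF NM[of s], of transpose] arg_cong[OF MN[of s], of transpose]
    by (simp_all add: transpose_simps tM)
  define C where "C s = N s ** P s" for s
  have C: "transpose (C s) ** C s = mat 1 \<and> C s - mat 1 = (s / 2) *\<^sub>R (K ** (C s + mat 1))" for s
  proof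
    have NP: "N s ** P s = P s ** N s"
    proof -
      have "N s ** P s = N s ** (P s ** M s) ** N s" by (simp add: MN flip: matrix_mul_assoc)
      also have "\<dots> = (N s ** M s) ** P s ** N s" by (simp add: matrix_mul_assoc flip: MP)
      finally show ?thesis by (simp add: NM)
    qed
    have "transpose (C s) ** C s = M s ** (transpose (N s) ** P s) ** N s"
      by (simp add: C_def NP[symmetric] transpose_simps tP matrix_mul_assoc)
        (simp add: NP flip: matrix_mul_assoc)
    then show "transpose (C s) ** C s = mat 1" by (simp add: tN MN)
    have "M s ** C s = P s" by (simp add: C_def matrix_mul_assoc MN)
    then show "C s - mat 1 = (s / 2) *\<^sub>R (K ** (C s + mat 1))"
      by (simp add: M_def P_def matrix_ring_simps algebra_simps)
  qed
  have "M 0 = mat 1" "P 0 = mat 1" by (simp_all add: M_def P_def)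
  then have "C 0 = mat 1" using NM[of 0] by (simp add: C_def)
  with C that show thesis by blast
qed

lemma Stiefel_curve:
  fixes Y :: "real^'p^('p::finite + 'q::finite)"
  assumes Y: "Y \<in> Stiefel" and v: "v \<in> Stiefel_tangent Y"
  shows "\<exists>\<gamma> :: real \<Rightarrow> _. (\<forall>s. \<gamma> s \<in> Stiefel) \<and> \<gamma> 0 = Y \<and> (\<gamma> has_vector_derivative v) (at 0)"
proof -
  define K where "K = v ** transpose Y - Y ** transpose v - Y ** transpose Y ** v ** transpose Y"
  have YY: "transpose Y ** Y = mat 1" using Y by (simp add: Stiefel_def)
  have tv: "transpose v ** Y = - (transpose Y ** v)"
    using v by (simp add: Stiefel_tangent_def antisym_iff transpose_simps)
  have tvZ: "transpose v ** (Y ** Z) = - (transpose Y ** (v ** Z))" for Z :: "real^'m^'p"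
    using arg_cong[OF tv, of "\<lambda>M. M ** Z"] by (simp add: matrix_ring_simps)
  have K: "K \<in> antisym_mats"
    by (simp add: K_def antisym_iff transpose_simps matrix_ring_simps tvZ)
  have KY: "K ** Y = v"
    by (simp add: K_def matrix_ring_simps YY tv mult_cancel_left[OF YY])
  obtain C :: "real \<Rightarrow> real^('p + 'q)^('p + 'q)" where
    C: "\<forall>s. transpose (C s) ** C s = mat 1" "C 0 = mat 1"
      "\<forall>s. C s - mat 1 = (s / 2) *\<^sub>R (K ** (C s + mat 1))"
    using cayley_curve[OF K] .
  note C1 = C(1)[rule_format] and C3 = C(3)[rule_format]
  define n where "n = norm (mat 1 :: real^('p + 'q)^('p + 'q))"
  have normC: "norm (C s) = n" for s
    using C1 trace_transpose_mult[of "C s" "C s"]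
      trace_transpose_mult[of "mat 1 :: real^('p + 'q)^('p + 'q)" "mat 1"]
    by (simp add: n_def norm_eq_sqrt_inner)
  obtain b1 where b1_ge: "b1 \<ge> 0" and b1: "\<And>M :: real^('p + 'q)^('p + 'q). norm (K ** K ** M) \<le> norm M * b1" 
    using bounded_linear.nonneg_bounded[OF bounded_bilinear.bounded_linear_right[OF bounded_bilinear_matrix_mult]]
    by blast
  obtain b2 where b2: "b2 \<ge> 0" "\<And>M :: real^('p + 'q)^('p + 'q). norm (M ** Y) \<le> norm M * b2" 
    using bounded_linear.nonneg_bounded[OF bounded_bilinear.bounded_linear_left[OF bounded_bilinear_matrix_mult]]
    by blast
  have bound: "norm (C s ** Y - C 0 ** Y - s *\<^sub>R v) \<le> (2 * n * b1 * b2 / 4) * s\<^sup>2" for s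
  proof -
    have "C s ** Y - C 0 ** Y - s *\<^sub>R v = (C s - mat 1 - s *\<^sub>R K) ** Y"
      by (simp add: matrix_ring_simps C(2) KY)
    also have "C s - mat 1 - s *\<^sub>R K = (s / 2) *\<^sub>R (K ** (C s - mat 1))"
      by (subst C3) (simp add: matrix_ring_simps, simp add: vec_eq_iff field_simps)
    also have "K ** (C s - mat 1) = (s / 2) *\<^sub>R (K ** K ** (C s + mat 1))"
      by (subst C3) (simp add: matrix_ring_simps)
    finally have "norm (C s ** Y - C 0 ** Y - s *\<^sub>R v) = (s\<^sup>2 / 4) * norm (K ** K ** (C s + mat 1) ** Y)"
      by (simp add: matrix_ring_simps power2_eq_square abs_mult)
    also have "\<dots> \<le> (s\<^sup>2 / 4) * (norm (C s + mat 1) * b1 * b2)"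
      using b1[of "C s + mat 1"] b2
      by (intro mult_left_mono order_trans[OF b2(2)] mult_right_mono) auto
    also have "\<dots> \<le> (s\<^sup>2 / 4) * ((n + n) * b1 * b2)"
      using norm_triangle_ineq[of "C s" "mat 1"] b1_ge b2(1)
      by (intro mult_left_mono mult_right_mono) (auto simp: normC simp flip: n_def)
    finally show ?thesis by (simp add: algebra_simps)
  qed
  have "C s ** Y \<in> Stiefel" for s
    by (simp add: Stiefel_def matrix_transpose_mul mult_cancel_left[OF C1] YY flip: matrix_mul_assoc)
  moreover have "((\<lambda>s. C s ** Y) has_vector_derivative v) (at 0)"
    by (rule has_vector_derivative_quadratic_bound[OF bound])
  ultimately show ?thesis
    using C(2) by (intro exI[of _ "\<lambda>s. C s ** Y"]) auto
qed

lemma subspace_Stiefel_tangent: "subspace (Stiefel_tangent Y)"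
  using subspace_antisym
  by (auto simp: subspace_def Stiefel_tangent_def matrix_ring_simps)

section \<open>The Levi-Civita connection and its curvature\<close>

interpretation stiefel: velocity_curves "Stiefel :: (real^'p^('p::finite + 'q::finite)) set" Stiefel_tangent
  by unfold_locales (rule subspace_Stiefel_tangent, rule Stiefel_curve)

definition stiefel_christoffel :: "real \<Rightarrow> real^'p^'n \<Rightarrow> real^'p^'n \<Rightarrow> real^'p^'n \<Rightarrow> real^'p^'n" where
  "stiefel_christoffel t Y V Z =
    (1 / 2) *\<^sub>R (Y ** (transpose V ** Z + transpose Z ** V)) +
    ((2 - t) / 2) *\<^sub>R ((mat 1 - Y ** transpose Y) ** (V ** transpose Z + Z ** transpose V) ** Y)"

definition stiefel_christoffel_deriv ::
  "real \<Rightarrow> real^'p^'n \<Rightarrow> real^'p^'n \<Rightarrow> real^'p^'n \<Rightarrow> real^'p^'n \<Rightarrow> real^'p^'n" where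
  "stiefel_christoffel_deriv t Y X V Z =
    (1 / 2) *\<^sub>R (X ** (transpose V ** Z + transpose Z ** V)) +
    ((2 - t) / 2) *\<^sub>R ((mat 1 - Y ** transpose Y) ** (V ** transpose Z + Z ** transpose V) ** X -
      (X ** transpose Y + Y ** transpose X) ** (V ** transpose Z + Z ** transpose V) ** Y)"

lemmas smooth_on_matrix_mult = smooth_on_bilinear[OF bounded_bilinear_matrix_mult]
lemmas smooth_on_transpose = smooth_on_linear_comp[OF bounded_linear_transpose]
lemmas matrix_smooth_intros = smooth_intros smooth_on_matrix_mult smooth_on_transpose

lemma stiefel_christoffel_smooth:
  "smooth_on S V \<Longrightarrow> smooth_on S Z \<Longrightarrow> smooth_on S (\<lambda>Y. stiefel_christoffel t Y (V Y) (Z Y))"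
  unfolding stiefel_christoffel_def by (intro matrix_smooth_intros)

lemma (in velocity_curves) dir_deriv_ring_rules:
  fixes F :: "'a \<Rightarrow> real^'n^'m" and G :: "'a \<Rightarrow> real^'k^'n"
  assumes "x \<in> S" "v \<in> Tan x"
  shows "dir_deriv S (\<lambda>y. y) x v = v"
    and "dir_deriv S (\<lambda>y. c) x v = 0"
    and "smooth_on S f \<Longrightarrow> dir_deriv S (\<lambda>y. a *\<^sub>R f y) x v = a *\<^sub>R dir_deriv S f x v"
    and "smooth_on S f \<Longrightarrow> smooth_on S g \<Longrightarrow>
      dir_deriv S (\<lambda>y. f y + g y) x v = dir_deriv S f x v + dir_deriv S g x v"
    and "smooth_on S f \<Longrightarrow> smooth_on S g \<Longrightarrow>
      dir_deriv S (\<lambda>y. f y - g y) x v = dir_deriv S f x v - dir_deriv S g x v"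
    and "smooth_on S F \<Longrightarrow> smooth_on S G \<Longrightarrow> dir_deriv S (\<lambda>y. F y ** G y) x v =
      F x ** dir_deriv S G x v + dir_deriv S F x v ** G x"
    and "smooth_on S F \<Longrightarrow> dir_deriv S (\<lambda>y. transpose (F y)) x v = transpose (dir_deriv S F x v)"
  using assms
  by (simp_all add: dir_deriv_ident dir_deriv_const dir_deriv_scaleR_const dir_deriv_add
      dir_deriv_diff dir_deriv_bilinear[OF bounded_bilinear_matrix_mult]
      dir_deriv_linear[OF bounded_linear_transpose])

lemma stiefel_christoffel_deriv:
  fixes Y :: "real^'p^('p::finite + 'q::finite)"
  assumes sm: "smooth_on Stiefel V" "smooth_on Stiefel Z" and Y: "Y \<in> Stiefel"
    and u: "u \<in> Stiefel_tangent Y"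
  shows "dir_deriv Stiefel (\<lambda>y. stiefel_christoffel t y (V y) (Z y)) Y u =
    stiefel_christoffel_deriv t Y u (V Y) (Z Y) + stiefel_christoffel t Y (dir_deriv Stiefel V Y u) (Z Y) +
    stiefel_christoffel t Y (V Y) (dir_deriv Stiefel Z Y u)"
proof -
  define V' where "V' = dir_deriv Stiefel V Y u"
  define Z' where "Z' = dir_deriv Stiefel Z Y u"
  have "dir_deriv Stiefel (\<lambda>y. stiefel_christoffel t y (V y) (Z y)) Y u =
    (1 / 2) *\<^sub>R (Y ** (transpose (V Y) ** Z' + transpose V' ** Z Y + (transpose (Z Y) ** V' + transpose Z' ** V Y))
       + u ** (transpose (V Y) ** Z Y + transpose (Z Y) ** V Y)) +
    ((2 - t) / 2) *\<^sub>R ((mat 1 - Y ** transpose Y) ** (V Y ** transpose (Z Y) + Z Y ** transpose (V Y)) ** u +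
      ((mat 1 - Y ** transpose Y) ** (V Y ** transpose Z' + V' ** transpose (Z Y) + (Z Y ** transpose V' + Z' ** transpose (V Y))) +
       (0 - (Y ** transpose u + u ** transpose Y)) ** (V Y ** transpose (Z Y) + Z Y ** transpose (V Y))) ** Y)"
    unfolding stiefel_christoffel_def
    by (simp only: stiefel.dir_deriv_ring_rules[OF Y u] matrix_smooth_intros sm V'_def Z'_def)
  then show ?thesis
    unfolding stiefel_christoffel_def stiefel_christoffel_deriv_def V'_def[symmetric] Z'_def[symmetric]
    by (simp add: matrix_ring_simps) (simp add: vec_eq_iff field_simps)
qed

lemma stiefel_christoffel_tangent:
  fixes Y :: "real^'p^('p::finite + 'q::finite)"
  assumes V: "vector_field Stiefel Stiefel_tangent V" and Z: "vector_field Stiefel Stiefel_tangent Z"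
    and Y: "Y \<in> Stiefel"
  shows "dir_deriv Stiefel Z Y (V Y) + stiefel_christoffel t Y (V Y) (Z Y) \<in> Stiefel_tangent Y"
proof -
  have sm: "smooth_on Stiefel Z" and tan: "\<And>y. y \<in> Stiefel \<Longrightarrow> Z y \<in> Stiefel_tangent y"
    and VY: "V Y \<in> Stiefel_tangent Y"
    using V Z Y by (auto simp: vector_field_def)
  have YY: "transpose Y ** Y = mat 1" using Y by (simp add: Stiefel_def)
  define Z' where "Z' = dir_deriv Stiefel Z Y (V Y)"
  have "dir_deriv Stiefel (\<lambda>y. transpose y ** Z y + transpose (Z y) ** y) Y (V Y) =
      dir_deriv Stiefel (\<lambda>y. 0) Y (V Y)"
    using tan by (intro dir_deriv_cong)
      (simp add: Stiefel_tangent_def antisym_iff transpose_simps)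
  then have eq: "transpose Y ** Z' + transpose (V Y) ** Z Y + (transpose (Z Y) ** V Y + transpose Z' ** Y) = 0"
    by (simp only: stiefel.dir_deriv_ring_rules[OF Y VY] matrix_smooth_intros sm Z'_def)
  have "transpose Y ** (Z' + stiefel_christoffel t Y (V Y) (Z Y)) =
      transpose Y ** Z' + (1 / 2) *\<^sub>R (transpose (V Y) ** Z Y + transpose (Z Y) ** V Y)"
    by (simp add: stiefel_christoffel_def matrix_ring_simps YY mult_cancel_left[OF YY])
  moreover have tZ: "transpose Z' ** Y =
      - (transpose Y ** Z' + transpose (V Y) ** Z Y + transpose (Z Y) ** V Y)"
    using eq by (simp only: eq_neg_iff_add_eq_0 add_ac)
  have "transpose (transpose Y ** Z' + (1 / 2) *\<^sub>R (transpose (V Y) ** Z Y + transpose (Z Y) ** V Y)) =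
      - (transpose Y ** Z' + (1 / 2) *\<^sub>R (transpose (V Y) ** Z Y + transpose (Z Y) ** V Y))"
    by (simp add: transpose_simps tZ) (simp add: vec_eq_iff field_simps)
  ultimately show ?thesis
    by (simp add: Stiefel_tangent_def antisym_iff Z'_def)
qed

interpretation stiefel: christoffel "Stiefel :: (real^'p^('p::finite + 'q::finite)) set" Stiefel_tangent
  "stiefel_christoffel t" "stiefel_christoffel_deriv t" for t
proof
  fix x u v w :: "real^'p^('p + 'q)" and c :: real
  show "stiefel_christoffel t x (u + v) w = stiefel_christoffel t x u w + stiefel_christoffel t x v w"
    by (simp add: stiefel_christoffel_def matrix_ring_simps transpose_simps algebra_simps)
  show "stiefel_christoffel t x (c *\<^sub>R u) w = c *\<^sub>R stiefel_christoffel t x u w"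
    by (simp add: stiefel_christoffel_def matrix_ring_simps transpose_simps algebra_simps)
  show "stiefel_christoffel t x u v = stiefel_christoffel t x v u"
    by (simp add: stiefel_christoffel_def add.commute)
qed (rule stiefel_christoffel_smooth stiefel_christoffel_deriv stiefel_christoffel_tangent; assumption)+

lemma stiefel_christoffel_decomp:
  fixes U :: "real^('p::finite + 'q::finite)^('p + 'q)"
  assumes U: "U \<in> SO_group"
  shows "stiefel_christoffel t (left_cols U) (left_cols U ** A + right_cols U ** B)
      (left_cols U ** A' + right_cols U ** B') =
    left_cols U ** ((1 / 2) *\<^sub>R (transpose A ** A' + transpose B ** B' + transpose A' ** A + transpose B' ** B)) +
    right_cols U ** (((2 - t) / 2) *\<^sub>R (B ** transpose A' + B' ** transpose A))"
  unfolding stiefel_christoffel_def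
  by (simp add: matrix_ring_simps transpose_simps SO_columns[OF U] algebra_simps)

lemma stiefel_christoffel_metric:
  fixes Y :: "real^'p^('p::finite + 'q::finite)"
  assumes Y: "Y \<in> Stiefel"
    and tan: "V \<in> Stiefel_tangent Y" "W \<in> Stiefel_tangent Y" "Z \<in> Stiefel_tangent Y"
  shows "stiefel_ip t Y (stiefel_christoffel t Y V W) Z + stiefel_ip t Y W (stiefel_christoffel t Y V Z) =
    (t / 2 - 1) * ((transpose V ** W) \<bullet> (transpose Y ** Z) + (transpose Y ** W) \<bullet> (transpose V ** Z))"
proof -
  obtain U :: "real^('p + 'q)^('p + 'q)" where U: "U \<in> SO_group" and YU: "Y = left_cols U"
    using Stiefel_extension[OF Y] by metis
  obtain A1 B1 A2 B2 A3 B3 where A: "A1 \<in> antisym_mats" "A2 \<in> antisym_mats" "A3 \<in> antisym_mats"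
    and V: "V = left_cols U ** A1 + right_cols U ** B1"
    and W: "W = left_cols U ** A2 + right_cols U ** B2"
    and Z: "Z = left_cols U ** A3 + right_cols U ** B3"
    using tan unfolding YU Stiefel_tangent_decomp[OF U] by metis
  have tr: "transpose A1 = - A1" "transpose A2 = - A2" "transpose A3 = - A3"
    using A by (simp_all add: antisym_iff)
  have sym1: "(transpose A1 ** A2 + transpose B1 ** B2 + transpose A2 ** A1 + transpose B2 ** B1) \<bullet> A3 = 0"
    by (rule inner_symmetric_antisymmetric[OF _ tr(3)]) (simp add: transpose_simps add_ac)
  have "(transpose A1 ** A3 + transpose B1 ** B3 + transpose A3 ** A1 + transpose B3 ** B1) \<bullet> A2 = 0"
    by (rule inner_symmetric_antisymmetric[OF _ tr(2)]) (simp add: transpose_simps add_ac)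
  then have sym2: "A2 \<bullet> (transpose A1 ** A3 + transpose B1 ** B3 + transpose A3 ** A1 + transpose B3 ** B1) = 0"
    by (simp only: inner_commute)
  have 1: "stiefel_ip t Y (stiefel_christoffel t Y V W) Z = ((2 - t) / 2) * ((- (B1 ** A2) - B2 ** A1) \<bullet> B3)"
    unfolding YU V W Z stiefel_christoffel_decomp[OF U] stiefel_ip_decomp[OF U] inner_scaleR_left sym1
    by (simp add: tr matrix_ring_simps)
  have 2: "stiefel_ip t Y W (stiefel_christoffel t Y V Z) = ((2 - t) / 2) * (B2 \<bullet> (- (B1 ** A3) - B3 ** A1))"
    unfolding YU V W Z stiefel_christoffel_decomp[OF U] stiefel_ip_decomp[OF U] inner_scaleR_right sym2
    by (simp add: tr matrix_ring_simps)
  have 3: "transpose V ** W = - (A1 ** A2) + transpose B1 ** B2" "transpose Y ** Z = A3"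
    "transpose V ** Z = - (A1 ** A3) + transpose B1 ** B3" "transpose Y ** W = A2"
    by (simp_all add: YU V W Z transpose_simps matrix_ring_simps SO_columns[OF U] tr)
  have 4: "(A1 ** A2) \<bullet> A3 = - (A2 \<bullet> (A1 ** A3))"
    by (simp add: inner_matrix_mult_left tr matrix_ring_simps)
  have 5: "(transpose B1 ** B2) \<bullet> A3 = B2 \<bullet> (B1 ** A3)" "A2 \<bullet> (transpose B1 ** B3) = (B1 ** A2) \<bullet> B3"
    by (simp_all add: inner_matrix_mult_left)
  have 6: "(B2 ** A1) \<bullet> B3 = - (B2 \<bullet> (B3 ** A1))"
    by (simp add: inner_matrix_mult_right tr matrix_ring_simps)
  show ?thesis
    unfolding 1 2 3
    by (simp add: inner_add_left inner_add_right inner_diff_left inner_diff_right 4 5 6 field_simps)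
qed

lemma stiefel_ip_add_left:
  "stiefel_ip t Y (u + v) w = stiefel_ip t Y u w + stiefel_ip t Y v w"
  by (simp add: stiefel_ip_def matrix_ring_simps inner_add_left algebra_simps)

lemma stiefel_ip_commute: "stiefel_ip t Y u v = stiefel_ip t Y v u"
  by (simp add: stiefel_ip_def inner_commute)

lemma stiefel_ip_definite:
  fixes Y :: "real^'p^('p::finite + 'q::finite)"
  assumes t: "t > 0" and Y: "Y \<in> Stiefel" and u: "u \<in> Stiefel_tangent Y" and 0: "stiefel_ip t Y u u = 0"
  shows "u = 0"
proof -
  obtain U :: "real^('p + 'q)^('p + 'q)" where U: "U \<in> SO_group" and YU: "Y = left_cols U"
    using Stiefel_extension[OF Y] by metis
  obtain A B where uAB: "u = left_cols U ** A + right_cols U ** B"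
    using u unfolding YU Stiefel_tangent_decomp[OF U] by metis
  have "(t / 2) * (A \<bullet> A) + B \<bullet> B = 0"
    using 0 unfolding YU uAB stiefel_ip_decomp[OF U] .
  moreover have "(t / 2) * (A \<bullet> A) \<ge> 0" "B \<bullet> B \<ge> 0" using t by simp_all
  ultimately have "(t / 2) * (A \<bullet> A) = 0" "B \<bullet> B = 0" by linarith+
  then show ?thesis using t by (simp add: uAB)
qed

lemma levi_civita_nabla:
  "levi_civita (Stiefel :: (real^'p^('p::finite + 'q::finite)) set) Stiefel_tangent (quotient_metric t)
    (stiefel.nabla t)"
  unfolding levi_civita_def
proof (intro conjI allI impI ballI; (elim conjE)?)
  show "affine_connection (Stiefel :: (real^'p^('p + 'q)) set) Stiefel_tangent (stiefel.nabla t)"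
    by (rule stiefel.affine_connection_nabla)
next
  fix V Z :: "real^'p^('p + 'q) \<Rightarrow> real^'p^('p + 'q)" and Y
  show "stiefel.nabla t V Z Y - stiefel.nabla t Z V Y = lie_bracket Stiefel V Z Y"
    by (rule stiefel.nabla_torsion_free)
next
  fix V W Z :: "real^'p^('p + 'q) \<Rightarrow> real^'p^('p + 'q)" and Y :: "real^'p^('p + 'q)"
  assume f: "vector_field Stiefel Stiefel_tangent V" "vector_field Stiefel Stiefel_tangent W"
    "vector_field Stiefel Stiefel_tangent Z" and Y: "Y \<in> Stiefel"
  have sm: "smooth_on Stiefel W" "smooth_on Stiefel Z"
    and tan: "\<And>y. y \<in> Stiefel \<Longrightarrow> V y \<in> Stiefel_tangent y"
      "\<And>y. y \<in> Stiefel \<Longrightarrow> W y \<in> Stiefel_tangent y"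
      "\<And>y. y \<in> Stiefel \<Longrightarrow> Z y \<in> Stiefel_tangent y"
    using f by (auto simp: vector_field_def)
  note VY = tan(1)[OF Y]
  define W' where "W' = dir_deriv Stiefel W Y (V Y)"
  define Z' where "Z' = dir_deriv Stiefel Z Y (V Y)"
  have nab: "stiefel.nabla t V W Y \<in> Stiefel_tangent Y" "stiefel.nabla t V Z Y \<in> Stiefel_tangent Y"
    using stiefel.vector_field_nabla[OF f(1,2)] stiefel.vector_field_nabla[OF f(1,3)] Y
    by (auto simp: vector_field_def)
  have inner: "smooth_on Stiefel (\<lambda>y. F y \<bullet> G y)"
      "dir_deriv Stiefel (\<lambda>y. F y \<bullet> G y) Y (V Y) =
        F Y \<bullet> dir_deriv Stiefel G Y (V Y) + dir_deriv Stiefel F Y (V Y) \<bullet> G Y"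
    if "smooth_on Stiefel F" "smooth_on Stiefel G" for F G :: "real^'p^('p + 'q) \<Rightarrow> 'c::euclidean_space"
    using that
    by (auto intro: smooth_on_bilinear[OF bounded_bilinear_inner]
        stiefel.dir_deriv_bilinear[OF bounded_bilinear_inner Y VY])
  have "dir_deriv Stiefel (\<lambda>y. quotient_metric t y (W y) (Z y)) Y (V Y) =
      dir_deriv Stiefel (\<lambda>y. W y \<bullet> Z y + (t / 2 - 1) *\<^sub>R ((transpose y ** W y) \<bullet> (transpose y ** Z y))) Y (V Y)"
    using tan by (intro dir_deriv_cong) (simp add: quotient_metric_eq stiefel_ip_def)
  also have "\<dots> = W Y \<bullet> Z' + W' \<bullet> Z Y + (t / 2 - 1) *\<^sub>R
      ((transpose Y ** W Y) \<bullet> (transpose Y ** Z' + transpose (V Y) ** Z Y) +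
       (transpose Y ** W' + transpose (V Y) ** W Y) \<bullet> (transpose Y ** Z Y))"
    by (simp only: stiefel.dir_deriv_ring_rules[OF Y VY] matrix_smooth_intros inner sm W'_def Z'_def)
  also have "\<dots> = stiefel_ip t Y (W' + stiefel_christoffel t Y (V Y) (W Y)) (Z Y) +
      stiefel_ip t Y (W Y) (Z' + stiefel_christoffel t Y (V Y) (Z Y))"
    using stiefel_christoffel_metric[OF Y tan(1)[OF Y] tan(2)[OF Y] tan(3)[OF Y], of t]
    by (simp add: stiefel_ip_add_left stiefel_ip_commute[of t Y "W Y"])
      (simp add: stiefel_ip_def inner_commute inner_add_left inner_add_right algebra_simps)
  finally show "dir_deriv Stiefel (\<lambda>y. quotient_metric t y (W y) (Z y)) Y (V Y) =
      quotient_metric t Y (stiefel.nabla t V W Y) (Z Y) + quotient_metric t Y (W Y) (stiefel.nabla t V Z Y)"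
    by (simp add: quotient_metric_eq Y nab tan) (simp add: stiefel.nabla_def W'_def Z'_def)
qed

lemma levi_civita_iff:
  fixes nab :: "(real^'p^('p::finite + 'q::finite) \<Rightarrow> real^'p^('p + 'q)) \<Rightarrow> _"
  assumes t: "t > 0"
  shows "levi_civita Stiefel Stiefel_tangent (quotient_metric t) nab \<longleftrightarrow>
    (\<forall>V Z. vector_field Stiefel Stiefel_tangent V \<and> vector_field Stiefel Stiefel_tangent Z \<longrightarrow>
      (\<forall>Y\<in>Stiefel. nab V Z Y = stiefel.nabla t V Z Y))" (is "?L \<longleftrightarrow> ?R")
proof
  assume L: ?L
  show ?R
  proof (intro allI impI ballI; elim conjE)
    fix V Z :: "real^'p^('p + 'q) \<Rightarrow> real^'p^('p + 'q)" and Y :: "real^'p^('p + 'q)"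
    assume f: "vector_field Stiefel Stiefel_tangent V" "vector_field Stiefel Stiefel_tangent Z"
      and Y: "Y \<in> Stiefel"
    have diff: "u - v \<in> Stiefel_tangent Y"
      if "u \<in> Stiefel_tangent Y" "v \<in> Stiefel_tangent Y" for u v
      using subspace_diff[OF subspace_Stiefel_tangent] that .
    show "nab V Z Y = stiefel.nabla t V Z Y"
    proof (rule stiefel.levi_civita_unique[OF L levi_civita_nabla f Y])
      fix u v w assume uvw: "u \<in> Stiefel_tangent Y" "v \<in> Stiefel_tangent Y" "w \<in> Stiefel_tangent Y"
      show "quotient_metric t Y (u - v) w = quotient_metric t Y u w - quotient_metric t Y v w"
        using stiefel_ip_add_left[of t Y "u - v" v w] by (simp add: quotient_metric_eq Y uvw diff)
    qed (use stiefel_ip_definite[OF t Y] in \<open>auto simp: quotient_metric_eq Y stiefel_ip_commute\<close>)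
  qed
next
  assume ?R
  then show ?L
    by (intro stiefel.levi_civita_cong[OF levi_civita_nabla]) blast
qed

lemma Stiefel_tangent_field:
  fixes Y :: "real^'p^('p::finite + 'q::finite)"
  assumes "Y \<in> Stiefel" "u \<in> Stiefel_tangent Y"
  shows "\<exists>X. vector_field Stiefel Stiefel_tangent X \<and> X Y = u"
proof -
  define X where "X y = u - (1 / 2) *\<^sub>R (y ** (transpose y ** u + transpose u ** y))"
    for y :: "real^'p^('p + 'q)"
  have "smooth_on Stiefel X"
    unfolding X_def[abs_def] by (intro matrix_smooth_intros)
  moreover have "X y \<in> Stiefel_tangent y" if "y \<in> Stiefel" for y
  proof -
    have yy: "transpose y ** y = mat 1" using that by (simp add: Stiefel_def)
    have "transpose y ** X y = (1 / 2) *\<^sub>R (transpose y ** u - transpose u ** y)"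
      by (simp add: X_def matrix_ring_simps mult_cancel_left[OF yy]) (simp add: vec_eq_iff field_simps)
    then show ?thesis
      by (simp only: Stiefel_tangent_def antisym_iff mem_Collect_eq)
        (simp add: transpose_simps algebra_simps)
  qed
  moreover have "X Y = u"
    using assms(2) by (simp add: X_def Stiefel_tangent_def antisym_iff transpose_simps)
  ultimately show ?thesis by (auto simp: vector_field_def)
qed

lemma stiefel_curvature_decomp:
  fixes U :: "real^('p::finite + 'q::finite)^('p + 'q)" and A1 A2 A3 :: "real^'p^'p"
    and B1 B2 B3 :: "real^'p^'q"
  assumes U: "U \<in> SO_group" and A: "A1 \<in> antisym_mats" "A2 \<in> antisym_mats" "A3 \<in> antisym_mats"
  defines "Y \<equiv> left_cols U" and "Yp \<equiv> right_cols U"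
  assumes X: "\<xi> = Y ** A1 + Yp ** B1" "\<eta> = Y ** A2 + Yp ** B2" "\<phi> = Y ** A3 + Yp ** B3"
  shows "stiefel_christoffel_deriv t Y \<eta> \<xi> \<phi> - stiefel_christoffel_deriv t Y \<xi> \<eta> \<phi> +
      stiefel_christoffel t Y \<eta> (stiefel_christoffel t Y \<xi> \<phi>) - stiefel_christoffel t Y \<xi> (stiefel_christoffel t Y \<eta> \<phi>) =
    Y ** stiefel_curvature_A (t / 2) A1 A2 A3 B1 B2 B3 + Yp ** stiefel_curvature_B (t / 2) A1 A2 A3 B1 B2 B3"
proof -
  have tr: "transpose A1 = - A1" "transpose A2 = - A2" "transpose A3 = - A3"
    using A by (simp_all add: antisym_iff)
  have g: "stiefel_christoffel t Y (Y ** A + Yp ** B) (Y ** A' + Yp ** B') =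
    Y ** ((1 / 2) *\<^sub>R (transpose A ** A' + transpose B ** B' + transpose A' ** A + transpose B' ** B)) +
    Yp ** (((2 - t) / 2) *\<^sub>R (B ** transpose A' + B' ** transpose A))" for A A' B B'
    unfolding Y_def Yp_def by (rule stiefel_christoffel_decomp[OF U])
  have YYp: "mat 1 - Y ** transpose Y = Yp ** transpose Yp"
    using orthogonal_columns(5)[OF SO_orthogonal[OF U]] by (simp add: Y_def Yp_def algebra_simps)
  note cols = SO_columns[OF U, folded Y_def Yp_def]
  show ?thesis
    unfolding X g stiefel_christoffel_deriv_def YYp stiefel_curvature_A_def stiefel_curvature_B_def comm_bracket_def
    by (simp only: matrix_ring_simps transpose_simps tr transpose_transpose cols
        times0_left times0_right matrix_mul_lid matrix_mul_rid add_0_left add_0_right)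
      (simp add: vec_eq_iff, simp add: field_simps power2_eq_square)
qed

lemma stiefel_has_curvature_at:
  fixes U :: "real^('p::finite + 'q::finite)^('p + 'q)" and A1 A2 A3 :: "real^'p^'p"
    and B1 B2 B3 :: "real^'p^'q"
  assumes t: "t > 0" and nab: "levi_civita Stiefel Stiefel_tangent (quotient_metric t) nab"
    and U: "U \<in> SO_group" and A: "A1 \<in> antisym_mats" "A2 \<in> antisym_mats" "A3 \<in> antisym_mats"
  defines "Y \<equiv> left_cols U" and "Yp \<equiv> right_cols U"
  shows "has_curvature_at Stiefel Stiefel_tangent nab Y
    (Y ** A1 + Yp ** B1) (Y ** A2 + Yp ** B2) (Y ** A3 + Yp ** B3)
    (Y ** stiefel_curvature_A (t / 2) A1 A2 A3 B1 B2 B3 + Yp ** stiefel_curvature_B (t / 2) A1 A2 A3 B1 B2 B3)"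
  unfolding has_curvature_at_def
proof (intro conjI allI impI; (elim conjE)?)
  have Y: "Y \<in> Stiefel" unfolding Y_def by (rule left_cols_Stiefel[OF U])
  have tan: "Y ** A + Yp ** B \<in> Stiefel_tangent Y" if "A \<in> antisym_mats" for A B
    unfolding Y_def Yp_def Stiefel_tangent_decomp[OF U] using that by blast
  show "\<exists>X Z W. vector_field Stiefel Stiefel_tangent X \<and> vector_field Stiefel Stiefel_tangent Z \<and>
      vector_field Stiefel Stiefel_tangent W \<and>
      X Y = Y ** A1 + Yp ** B1 \<and> Z Y = Y ** A2 + Yp ** B2 \<and> W Y = Y ** A3 + Yp ** B3"
    using Stiefel_tangent_field[OF Y tan[OF A(1)], of B1] Stiefel_tangent_field[OF Y tan[OF A(2)], of B2]
      Stiefel_tangent_field[OF Y tan[OF A(3)], of B3] by blast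
  fix X Z W
  assume f: "vector_field Stiefel Stiefel_tangent X" "vector_field Stiefel Stiefel_tangent Z"
      "vector_field Stiefel Stiefel_tangent W"
    and val: "X Y = Y ** A1 + Yp ** B1" "Z Y = Y ** A2 + Yp ** B2" "W Y = Y ** A3 + Yp ** B3"
  have eq: "nab V W y = stiefel.nabla t V W y"
    if "vector_field Stiefel Stiefel_tangent V" "vector_field Stiefel Stiefel_tangent W" "y \<in> Stiefel"
    for V W y
    using nab that unfolding levi_civita_iff[OF t] by blast
  show "curvature_field Stiefel nab X Z W Y =
      Y ** stiefel_curvature_A (t / 2) A1 A2 A3 B1 B2 B3 + Yp ** stiefel_curvature_B (t / 2) A1 A2 A3 B1 B2 B3"
    using stiefel_curvature_decomp[OF U A, folded Y_def Yp_def, OF val]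
    by (simp add: stiefel.curvature_field_christoffel[OF eq f Y])
qed

lemma stiefel_curvature_A_antisym:
  assumes "A1 \<in> antisym_mats" "A2 \<in> antisym_mats" "A3 \<in> antisym_mats"
  shows "stiefel_curvature_A \<alpha> A1 A2 A3 B1 B2 B3 \<in> antisym_mats"
proof -
  have "transpose A1 = - A1" "transpose A2 = - A2" "transpose A3 = - A3"
    using assms by (simp_all add: antisym_iff)
  then show ?thesis
    by (simp add: antisym_iff stiefel_curvature_A_def comm_bracket_def transpose_simps matrix_ring_simps)
      (simp add: vec_eq_iff field_simps)
qed

theorem proposition7:
  fixes t :: real
  assumes "t > 0"
  shows
    "(\<forall>U :: real^('p::finite + 'q::finite)^('p + 'q). U \<in> SO_group \<longrightarrow>
        (let Y = left_cols U; Yp = right_cols U in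
         \<forall>\<eta>\<in>Stiefel_tangent Y. \<forall>v. is_horizontal_lift U \<eta> v \<longleftrightarrow>
           v = join_cols \<eta> (- (Y ** transpose \<eta> ** Yp)))) \<and>
     (\<forall>Y \<in> (Stiefel :: (real^'p^('p + 'q)) set). \<forall>\<eta>\<in>Stiefel_tangent Y.
        quotient_metric t Y \<eta> \<eta> =
          trace (\<eta> ** transpose \<eta> +
            (t / 2 - 1) *\<^sub>R (Y ** transpose Y ** \<eta> ** transpose \<eta>))) \<and>
     (\<forall>nab :: (real^'p^('p + 'q) \<Rightarrow> real^'p^('p + 'q)) \<Rightarrow> (real^'p^('p + 'q) \<Rightarrow> real^'p^('p + 'q)) \<Rightarrow>
          real^'p^('p + 'q) \<Rightarrow> real^'p^('p + 'q).
        levi_civita Stiefel Stiefel_tangent (quotient_metric t) nab \<longleftrightarrow>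
        (\<forall>V Z. vector_field Stiefel Stiefel_tangent V \<and> vector_field Stiefel Stiefel_tangent Z \<longrightarrow>
          (\<forall>Y\<in>Stiefel. nab V Z Y =
             dir_deriv Stiefel Z Y (V Y)
             + (1 / 2) *\<^sub>R (Y ** (transpose (V Y) ** Z Y + transpose (Z Y) ** V Y))
             + ((2 - t) / 2) *\<^sub>R ((mat 1 - Y ** transpose Y) **
                  (V Y ** transpose (Z Y) + Z Y ** transpose (V Y)) ** Y)))) \<and>
     (\<forall>nab :: (real^'p^('p + 'q) \<Rightarrow> real^'p^('p + 'q)) \<Rightarrow> (real^'p^('p + 'q) \<Rightarrow> real^'p^('p + 'q)) \<Rightarrow>
          real^'p^('p + 'q) \<Rightarrow> real^'p^('p + 'q).
      \<forall>U :: real^('p + 'q)^('p + 'q).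
      \<forall>(A1 :: real^'p^'p) A2 A3 (B1 :: real^'p^'q) B2 B3.
        levi_civita Stiefel Stiefel_tangent (quotient_metric t) nab \<and> U \<in> SO_group \<and>
        A1 \<in> antisym_mats \<and> A2 \<in> antisym_mats \<and> A3 \<in> antisym_mats \<longrightarrow>
        (let Y = left_cols U; Yp = right_cols U;
             \<xi> = Y ** A1 + Yp ** B1; \<eta> = Y ** A2 + Yp ** B2; \<phi> = Y ** A3 + Yp ** B3;
             \<omega>1 = blk A1 B1 0; \<omega>2 = blk A2 B2 0; \<omega>3 = blk A3 B3 0;
             Rhat = oproj m_sub
               ((1/2) *\<^sub>R bracket_P t (comm_bracket \<omega>1 \<omega>2) \<omega>3
                - (1/4) *\<^sub>R bracket_P t \<omega>1 (bracket_P t \<omega>2 \<omega>3)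
                + (1/4) *\<^sub>R bracket_P t \<omega>2 (bracket_P t \<omega>1 \<omega>3)
                + (1/2) *\<^sub>R ad_dagger t \<omega>3 (oproj k_sub (comm_bracket \<omega>1 \<omega>2))
                - (1/4) *\<^sub>R ad_dagger t \<omega>1 (oproj k_sub (comm_bracket \<omega>2 \<omega>3))
                + (1/4) *\<^sub>R ad_dagger t \<omega>2 (oproj k_sub (comm_bracket \<omega>1 \<omega>3)));
             \<alpha> = t / 2;
             AR = ((1 - 2 * \<alpha>) / 4) *\<^sub>R
                 (A1 ** transpose B3 ** B2 - A2 ** transpose B3 ** B1
                  - transpose B1 ** B3 ** A2 + transpose B2 ** B3 ** A1)
               + ((1 - \<alpha>) / 2) *\<^sub>R
                 (A3 ** transpose B1 ** B2 - A3 ** transpose B2 ** B1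
                  - transpose B1 ** B2 ** A3 + transpose B2 ** B1 ** A3)
               + (1/4) *\<^sub>R
                 (comm_bracket (comm_bracket A1 A2) A3
                  - A1 ** transpose B2 ** B3 + A2 ** transpose B1 ** B3
                  + transpose B3 ** B1 ** A2 - transpose B3 ** B2 ** A1);
             BR = ((2 * \<alpha>\<^sup>2 - \<alpha>) / 2) *\<^sub>R (B1 ** A3 ** A2 - B2 ** A3 ** A1)
               + (\<alpha>\<^sup>2 - \<alpha>) *\<^sub>R (B3 ** A1 ** A2 - B3 ** A2 ** A1)
               + (1 - \<alpha>) *\<^sub>R (B3 ** transpose B1 ** B2 - B3 ** transpose B2 ** B1)
               + ((\<alpha> - 2) / 2) *\<^sub>R (B1 ** transpose B2 ** B3 - B2 ** transpose B1 ** B3)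
               + (\<alpha> / 2) *\<^sub>R
                 (B1 ** A2 ** A3 - B1 ** transpose B3 ** B2
                  - B2 ** A1 ** A3 + B2 ** transpose B3 ** B1)
         in has_curvature_at Stiefel Stiefel_tangent nab Y \<xi> \<eta> \<phi> (Y ** AR + Yp ** BR) \<and>
            is_horizontal_lift U (Y ** AR + Yp ** BR) (U ** Rhat) \<and>
            Rhat = blk AR BR 0))"
proof (intro conjI allI impI ballI, goal_cases)
  case (1 U)
  then show ?case by (simp add: horizontal_lift_eq_join_cols Let_def)
next
  case (2 Y \<eta>)
  then show ?case by (simp add: quotient_metric_eq stiefel_ip_trace)
next
  case (3 nab)
  show ?case
    unfolding levi_civita_iff[OF assms] stiefel.nabla_def stiefel_christoffel_def add.assoc ..
next
  case (4 nab U A1 A2 A3 B1 B2 B3)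
  then have nab: "levi_civita Stiefel Stiefel_tangent (quotient_metric t) nab"
    and U: "U \<in> SO_group"
    and A: "A1 \<in> antisym_mats" "A2 \<in> antisym_mats" "A3 \<in> antisym_mats"
    by blast+
  have t: "t \<noteq> 0" using assms by simp
  show ?case
    unfolding Let_def lifted_curvature_eq[OF t A refl refl refl]
      stiefel_curvature_A_def[symmetric] stiefel_curvature_B_def[symmetric]
    by (intro conjI stiefel_has_curvature_at assms nab U A refl)
      (simp add: horizontal_lift_iff[OF U] stiefel_curvature_A_antisym A)
qed

end
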